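(* Let $\varepsilon>0$, $A\ge 0$ and $C>0$. Let $Q$ be large, let $2\le N\le Q^{1-\varepsilon}$, let $(a_m)_{m\ge1}$, $(b_n)_{n\ge1}$ be any complex numbers with $$|a_m|\le m^{-1/2}\tau(m)^A,\qquad |b_n|\le n^{-1/2}\tau(n)^A ,$$ and let $F(x,y)$ be a smooth function supported in $1\le x,y\le N$ such that $x^iy^j|F^{(i,j)}(x,y)|\le 1$ for $0\le i,j\le 2$. Then $$\mathcal S(\mathcal A\times\mathcal B)=\mathcal S_{diag}(\mathcal A\times\mathcal B)+O\big(Q(\log Q)^{-C}\big),$$ where the implied constant depends only on $\varepsilon$, $C$, $A$ (and the fixed function $\Psi$).
   Context: $\Psi$ is a fixed smooth function of compact support in $\mathbb R^+=(0,\infty)$; $Q$ is a large parameter. $\tau$ is the divisor function, $\varphi$ is Euler's function, $F^{(i,j)}=\partial_x^i\partial_y^jF$. $\sum^{*}_{\chi\,(\bmod q)}$ denotes summation over the primitive Dirichlet characters $\chi$ modulo $q$ (for $q=1$ this is the trivial character). For positive integers $m,n$, $$\Delta(m,n)=\sum_{q\ge1}\frac{\Psi(q/Q)}{\varphi(q)}\sum^{*}_{\chi\,(\bmod q)}\chi(m)\overline{\chi}(n).$$ For sequences $\mathcal A=(a_m)$, $\mathcal B=(b_n)$, $$\mathcal S(\mathcal A\times\mathcal B)=\sum_{m\ge1}\sum_{n\ge1}a_mb_nF(m,n)\Delta(m,n),\qquad \mathcal S_{diag}(\mathcal A\times\mathcal B)=\sum_{m\ge1}a_mb_mF(m,m)\Delta(m,m).$$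 *)

theory Defs
  imports "HOL-Analysis.Analysis" "HOL-Number_Theory.Number_Theory"
begin

section \<open>Dirichlet characters\<close>

definition dirichlet_character :: "nat \<Rightarrow> (nat \<Rightarrow> complex) \<Rightarrow> bool" where
  "dirichlet_character q ch \<longleftrightarrow>
     ch 1 = 1 \<and>
     (\<forall>m n. ch (m * n) = ch m * ch n) \<and>
     (\<forall>n. ch (n + q) = ch n) \<and>
     (\<forall>n. ch n = 0 \<longleftrightarrow> \<not> coprime n q)"

text \<open>For modulus 1 the trivial character (constantly 1) is primitive; a modulus \<open>q > 1\<close>
  rules out the principal character, which is induced from modulus 1.\<close>
definition primitive_character :: "nat \<Rightarrow> (nat \<Rightarrow> complex) \<Rightarrow> bool" where
  "primitive_character q ch \<longleftrightarrow>
     dirichlet_character q ch \<and>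
     \<not> (\<exists>d \<psi>. d dvd q \<and> d < q \<and> dirichlet_character d \<psi> \<and>
           (\<forall>n. coprime n q \<longrightarrow> ch n = \<psi> n))"

text \<open>Sums over the primitive characters of a fixed modulus are genuine finite sums:\<close>

lemma dirichlet_character_mod:
  assumes "dirichlet_character q ch"
  shows "ch (n mod q) = ch n"
proof -
  have "ch (r + k * q) = ch r" for r k
  proof (induction k)
    case (Suc k)
    have "ch (r + Suc k * q) = ch ((r + k * q) + q)"
      by (simp add: algebra_simps)
    then show ?case
      using assms Suc by (simp add: dirichlet_character_def)
  qed simp
  from this[of "n mod q" "n div q"] show ?thesis by simp
qed

lemma dirichlet_character_power:
  assumes "dirichlet_character q ch"
  shows "ch (n ^ k) = ch n ^ k"
  using assms by (induction k) (auto simp: dirichlet_character_def)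

lemma finite_primitive_characters:
  assumes "q \<ge> 1"
  shows "finite {ch. primitive_character q ch}"
proof -
  let ?R = "insert 0 {z::complex. z ^ totient q = 1}"
  let ?S = "{ch. dirichlet_character q ch}"
  have pos: "totient q \<ge> 1"
    using assms by (simp add: Suc_leI)
  have finR: "finite ?R"
    using finite_roots_unity[OF pos, where 'a = complex] by simp
  have val: "ch n \<in> ?R" if ch: "dirichlet_character q ch" for ch n
  proof (cases "coprime n q")
    case True
    then have "n ^ totient q mod q = 1 mod q"
      using euler_theorem[of n q] by (simp add: cong_def)
    then have "ch (n ^ totient q) = ch 1"
      by (metis dirichlet_character_mod[OF ch])
    then show ?thesis
      using dirichlet_character_power[OF ch, of n "totient q"] ch
      by (simp add: dirichlet_character_def)
  next
    case False
    then show ?thesis using ch by (simp add: dirichlet_character_def)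
  qed
  have "inj_on (\<lambda>ch. restrict ch {..<q}) ?S"
  proof (rule inj_onI, rule ext)
    fix ch \<psi> n
    assume ch: "ch \<in> ?S" and \<psi>: "\<psi> \<in> ?S"
      and eq: "restrict ch {..<q} = restrict \<psi> {..<q}"
    have "n mod q \<in> {..<q}" using assms by simp
    then have "ch (n mod q) = \<psi> (n mod q)"
      using fun_cong[OF eq, of "n mod q"] by simp
    then show "ch n = \<psi> n"
      using ch \<psi> by (simp add: dirichlet_character_mod)
  qed
  moreover have "(\<lambda>ch. restrict ch {..<q}) ` ?S \<subseteq> PiE {..<q} (\<lambda>_. ?R)"
  proof (rule image_subsetI)
    fix ch assume "ch \<in> ?S"
    then have "dirichlet_character q ch" by simp
    then show "restrict ch {..<q} \<in> PiE {..<q} (\<lambda>_. ?R)"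
      by (intro restrict_PiE_iff[THEN iffD2] ballI val)
  qed
  moreover have "finite (PiE {..<q} (\<lambda>_. ?R))"
    by (rule finite_PiE) (use finR in auto)
  ultimately have "finite ?S"
    by (meson finite_imageD finite_subset)
  then show ?thesis
    by (rule rev_finite_subset) (auto simp: primitive_character_def)
qed


section \<open>Smooth functions of one and two real variables\<close>

definition smooth :: "(real \<Rightarrow> complex) \<Rightarrow> bool" where
  "smooth f \<longleftrightarrow>
     (\<forall>k x. ((\<lambda>g t. vector_derivative g (at t)) ^^ k) f differentiable (at x))"

definition dx :: "(real \<Rightarrow> real \<Rightarrow> complex) \<Rightarrow> real \<Rightarrow> real \<Rightarrow> complex" where
  "dx F = (\<lambda>x y. vector_derivative (\<lambda>t. F t y) (at x))"

definition dy :: "(real \<Rightarrow> real \<Rightarrow> complex) \<Rightarrow> real \<Rightarrow> real \<Rightarrow> complex" where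
  "dy F = (\<lambda>x y. vector_derivative (\<lambda>t. F x t) (at y))"

definition mixed_partial :: "nat \<Rightarrow> nat \<Rightarrow> (real \<Rightarrow> real \<Rightarrow> complex) \<Rightarrow> real \<Rightarrow> real \<Rightarrow> complex" where
  "mixed_partial i j F = (dx ^^ i) ((dy ^^ j) F)"

text \<open>\<open>C_class2 k F\<close>: all partial derivatives of \<open>F\<close> of order at most \<open>k\<close>, in any order of the
  variables, exist on the whole plane and are jointly continuous. The differentiability
  clauses are needed because \<^const>\<open>vector_derivative\<close> is total.\<close>
primrec C_class2 :: "nat \<Rightarrow> (real \<Rightarrow> real \<Rightarrow> complex) \<Rightarrow> bool" where
  "C_class2 0 F \<longleftrightarrow> continuous_on UNIV (\<lambda>(x, y). F x y)"
| "C_class2 (Suc k) F \<longleftrightarrow>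
     continuous_on UNIV (\<lambda>(x, y). F x y) \<and>
     (\<forall>x y. (\<lambda>t. F t y) differentiable (at x)) \<and>
     (\<forall>x y. (\<lambda>t. F x t) differentiable (at y)) \<and>
     C_class2 k (dx F) \<and> C_class2 k (dy F)"

definition smooth2 :: "(real \<Rightarrow> real \<Rightarrow> complex) \<Rightarrow> bool" where
  "smooth2 F \<longleftrightarrow> (\<forall>k. C_class2 k F)"


section \<open>The sums\<close>

definition divisor_tau :: "nat \<Rightarrow> nat" where
  "divisor_tau n = card {d. d dvd n}"

text \<open>All infinite sums below have finite support when \<open>\<Psi>\<close> has compact support in
  \<open>(0, \<infinity>)\<close>, \<open>F\<close> has bounded support and \<open>Q > 0\<close>.\<close>

definition Delta :: "(real \<Rightarrow> complex) \<Rightarrow> real \<Rightarrow> nat \<Rightarrow> nat \<Rightarrow> complex" where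
  "Delta \<Psi> Q m n =
     (\<Sum>\<^sub>\<infinity>q\<in>{1..}. \<Psi> (real q / Q) / of_nat (totient q) *
        (\<Sum>ch | primitive_character q ch. ch m * cnj (ch n)))"

definition S_full ::
  "(real \<Rightarrow> complex) \<Rightarrow> real \<Rightarrow> (real \<Rightarrow> real \<Rightarrow> complex) \<Rightarrow> (nat \<Rightarrow> complex) \<Rightarrow> (nat \<Rightarrow> complex) \<Rightarrow> complex"
where
  "S_full \<Psi> Q F a b =
     (\<Sum>\<^sub>\<infinity>m\<in>{1..}. \<Sum>\<^sub>\<infinity>n\<in>{1..}. a m * b n * F (real m) (real n) * Delta \<Psi> Q m n)"

definition S_diag ::
  "(real \<Rightarrow> complex) \<Rightarrow> real \<Rightarrow> (real \<Rightarrow> real \<Rightarrow> complex) \<Rightarrow> (nat \<Rightarrow> complex) \<Rightarrow> (nat \<Rightarrow> complex) \<Rightarrow> complex"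
where
  "S_diag \<Psi> Q F a b =
     (\<Sum>\<^sub>\<infinity>m\<in>{1..}. a m * b m * F (real m) (real m) * Delta \<Psi> Q m m)"

end

theory Submission
  imports Defs "HOL-Computational_Algebra.Squarefree" "HOL-Real_Asymp.Real_Asymp"
begin

text \<open>The off-diagonal terms are few enough to be estimated one by one. If
  \<open>\<bar>\<Delta>(m,n)\<bar> \<le> Q\<^bsup>o(1)\<^esup>\<close> for \<open>m \<noteq> n\<close>, then, as the coefficients are
  \<open>m\<^bsup>-1/2\<^esup> Q\<^bsup>o(1)\<^esup>\<close> and \<open>\<bar>F\<bar> \<le> 1\<close>, the terms with \<open>m \<noteq> n\<close> contribute at most
  \<open>(\<Sum>m\<le>N. m\<^bsup>-1/2\<^esup>)\<^sup>2 Q\<^bsup>o(1)\<^esup> \<le> 4 N Q\<^bsup>o(1)\<^esup>\<close>. Since \<open>N \<le> Q powr (1 - \<epsilon>)\<close>, this saves a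
  power of \<open>Q\<close>, which is more than any power of \<open>log Q\<close>.

  The bound for \<open>\<Delta>(m,n)\<close> rests on the orthogonality of characters. Every Dirichlet
  character modulo \<open>q\<close> is induced by exactly one primitive character, whose modulus \<open>d\<close>
  divides \<open>q\<close>. So, for \<open>m\<close> and \<open>n\<close> coprime to \<open>q\<close>, Moebius inversion over the divisors of \<open>q\<close> expresses the sum of
  \<open>\<chi>(m) cnj (\<chi>(n))\<close> over primitive \<open>\<chi>\<close> modulo \<open>q\<close> by the complete sums modulo the divisors
  \<open>d\<close> of \<open>q\<close>. The complete sum modulo \<open>d\<close> vanishes unless \<open>d\<close> divides \<open>m - n\<close>, and its
  absolute value is at most \<open>d\<close>. Hence the primitive sum is at most the sum of the common divisors \<open>d\<close> of
  \<open>q\<close> and \<open>m - n\<close> (\<open>norm_sum_primitive_characters_le\<close>). As \<open>m - n \<noteq> 0\<close> has only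
  \<open>Q\<^bsup>o(1)\<^esup>\<close> divisors, as \<open>\<phi>(q) \<ge> q / \<tau>(q)\<close>, and as \<open>\<Sum>d/q\<close> over the multiples \<open>q\<close> of \<open>d\<close>
  up to a constant times \<open>Q\<close> is \<open>O(log Q)\<close>, the required bound follows
  (\<open>norm_Delta_le\<close>, \<open>divisor_bound\<close>).

  The one non-formal ingredient of orthogonality is that characters separate the residue
  classes coprime to \<open>q\<close>. This is proved by extending a character from a subgroup, one
  generator at a time (\<open>extension_step\<close>).\<close>

section \<open>Extending characters from subgroups of the unit residues\<close>

text \<open>A character of a subgroup of the units modulo \<open>q\<close>. The subgroup is represented by the
  set of all natural numbers that lie in its residue classes; closure under inverses is
  automatic because \<open>x ^ (totient q - 1)\<close> is an inverse of \<open>x\<close>.\<close>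

locale partial_character =
  fixes q :: nat and H :: "nat set" and f :: "nat \<Rightarrow> complex"
  assumes modulus_pos: "q > 0"
    and coprime_mem: "x \<in> H \<Longrightarrow> coprime x q"
    and one_mem: "1 \<in> H"
    and mult_mem: "x \<in> H \<Longrightarrow> y \<in> H \<Longrightarrow> x * y \<in> H"
    and cong_mem: "x \<in> H \<Longrightarrow> [x = y] (mod q) \<Longrightarrow> y \<in> H"
    and f_cong: "x \<in> H \<Longrightarrow> [x = y] (mod q) \<Longrightarrow> f x = f y"
    and f_mult: "x \<in> H \<Longrightarrow> y \<in> H \<Longrightarrow> f (x * y) = f x * f y"
    and f_one: "f 1 = 1"
begin

lemma power_mem: "x \<in> H \<Longrightarrow> x ^ k \<in> H"
  by (induction k) (use one_mem in \<open>auto simp: mult_mem\<close>)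

lemma f_power: "x \<in> H \<Longrightarrow> f (x ^ k) = f x ^ k"
  by (induction k) (use f_one in \<open>auto simp: f_mult power_mem\<close>)

lemma f_nonzero:
  assumes "x \<in> H"
  shows "f x \<noteq> 0"
proof
  assume "f x = 0"
  moreover have "f x ^ totient q = 1"
    using f_cong[OF power_mem[OF assms] euler_theorem[OF coprime_mem[OF assms]]] f_one
    by (simp add: f_power[OF assms])
  ultimately show False
    using modulus_pos by (simp add: power_0_left split: if_splits)
qed

text \<open>This plays the role of closure under inverses.\<close>
lemma cancel_mem:
  assumes "x \<in> H" "x * y \<in> H"
  shows "y \<in> H"
proof -
  have "x ^ (totient q - 1) * (x * y) = x ^ totient q * y"
    using modulus_pos by (cases "totient q") (auto simp: algebra_simps)
  also have "[x ^ totient q * y = 1 * y] (mod q)"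
    by (intro cong_mult euler_theorem coprime_mem assms cong_refl)
  finally have "[x ^ (totient q - 1) * (x * y) = y] (mod q)" by (simp only: mult_1)
  then show ?thesis
    by (rule cong_mem[OF mult_mem[OF power_mem[OF assms(1)] assms(2)]])
qed

text \<open>A character of a subgroup extends to the subgroup generated by it and one more unit
  \<open>g\<close>. If \<open>k\<close> is the order of \<open>g\<close> modulo \<open>H\<close>, the only relation between \<open>g\<close> and \<open>H\<close> is that
  \<open>g ^ k\<close> lies in \<open>H\<close>, so any \<open>k\<close>-th root \<open>w\<close> of \<open>f (g ^ k)\<close> may be prescribed as the value at
  \<open>g\<close>. The freedom in the choice of \<open>w\<close> is what makes characters separate residues.\<close>
lemma extension_step:
  assumes g: "coprime g q"
    and k: "k > 0" "g ^ k \<in> H" "\<And>l. 0 < l \<Longrightarrow> g ^ l \<in> H \<Longrightarrow> k \<le> l"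
    and w: "w ^ k = f (g ^ k)"
  shows "\<exists>H' f'. partial_character q H' f' \<and> H \<subseteq> H' \<and> g \<in> H' \<and> f' g = w \<and> (\<forall>x\<in>H. f' x = f x)"
proof -
  have cop_gp: "coprime (g ^ j) q" for j
    using g by simp
  have f_gpow: "f (g ^ l) = w ^ l" if l: "g ^ l \<in> H" for l
  proof -
    have eq: "g ^ l = (g ^ k) ^ (l div k) * g ^ (l mod k)"
      by (metis mult_div_mod_eq power_add power_mult)
    have "g ^ (l mod k) \<in> H"
      using cancel_mem[OF power_mem[OF k(2)]] l eq by metis
    with k(3)[of "l mod k"] k(1) have "l mod k = 0"
      by (metis bot_nat_0.not_eq_extremum linorder_not_less mod_less_divisor)
    then have "l = k * (l div k)" by auto
    then show ?thesis
      using f_power[OF k(2), of "l div k"] w eq \<open>l mod k = 0\<close>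
      by (metis mult.right_neutral power_0 power_mult)
  qed
  have wd_le: "f h * w ^ i = f h' * w ^ j"
    if "h \<in> H" "h' \<in> H" "[h * g ^ i = h' * g ^ j] (mod q)" "j \<le> i" for h h' i j
  proof -
    from \<open>j \<le> i\<close> obtain l where l: "i = j + l" using le_Suc_ex by blast
    have "[(h * g ^ l) * g ^ j = h' * g ^ j] (mod q)"
      using that(3) by (simp add: l power_add mult_ac)
    then have c: "[h' = h * g ^ l] (mod q)"
      using cop_gp[of j] by (simp add: cong_mult_rcancel_nat cong_sym)
    then have gl: "g ^ l \<in> H"
      by (rule cancel_mem[OF \<open>h \<in> H\<close> cong_mem[OF \<open>h' \<in> H\<close>]])
    have "f h' = f h * w ^ l"
      using f_cong[OF \<open>h' \<in> H\<close> c] f_mult[OF \<open>h \<in> H\<close> gl] f_gpow[OF gl] by simp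
    then show ?thesis by (simp add: l power_add)
  qed
  \<comment> \<open>The value \<open>f h * w ^ j\<close> depends only on the residue of \<open>h * g ^ j\<close>.\<close>
  have wd: "f h * w ^ i = f h' * w ^ j"
    if "h \<in> H" "h' \<in> H" "[h * g ^ i = h' * g ^ j] (mod q)" for h h' i j
    using wd_le[OF that] wd_le[OF that(2,1) cong_sym[OF that(3)]] by (cases "j \<le> i") auto
  define rep where "rep n h j \<longleftrightarrow> h \<in> H \<and> [n = h * g ^ j] (mod q)" for n h j
  define H' where "H' = {n. \<exists>h j. rep n h j}"
  define f' where "f' n = (SOME v. \<exists>h j. rep n h j \<and> v = f h * w ^ j)" for n
  have f': "f' n = f h * w ^ j" if "rep n h j" for n h j
  proof -
    have "\<exists>h' j'. rep n h' j' \<and> f' n = f h' * w ^ j'"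
      unfolding f'_def by (rule someI_ex) (use that in blast)
    then obtain h' j' where h': "rep n h' j'" "f' n = f h' * w ^ j'" by blast
    have "[h' * g ^ j' = h * g ^ j] (mod q)"
      using h'(1) that unfolding rep_def by (meson cong_sym cong_trans)
    then show ?thesis
      using h' that wd unfolding rep_def by simp
  qed
  have rep_mult: "rep (x * y) (h * h') (i + j)" if "rep x h i" "rep y h' j" for x y h h' i j
  proof -
    have "[x * y = (h * g ^ i) * (h' * g ^ j)] (mod q)"
      using that unfolding rep_def by (intro cong_mult) auto
    also have "(h * g ^ i) * (h' * g ^ j) = (h * h') * g ^ (i + j)"
      by (simp add: power_add mult_ac)
    finally show ?thesis using that unfolding rep_def by (simp add: mult_mem)
  qed
  have rep_cong: "rep y h j" if "rep x h j" "[x = y] (mod q)" for x y h j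
    using that unfolding rep_def by (meson cong_sym cong_trans)
  have rep_H: "rep x x 0" if "x \<in> H" for x
    using that by (simp add: rep_def)
  have rep_g: "rep g 1 1"
    using one_mem by (simp add: rep_def)
  have "partial_character q H' f'"
  proof
    show "q > 0" by (rule modulus_pos)
    show "coprime x q" if x: "x \<in> H'" for x
    proof -
      obtain h j where "h \<in> H" "[x = h * g ^ j] (mod q)"
        using x unfolding H'_def rep_def by blast
      moreover from this have "coprime (h * g ^ j) q"
        using coprime_mem cop_gp by simp
      ultimately show ?thesis
        using cong_imp_coprime cong_sym by blast
    qed
    show "1 \<in> H'" using rep_H[OF one_mem] unfolding H'_def by blast
    show "x * y \<in> H'" if "x \<in> H'" "y \<in> H'" for x y
      using that rep_mult unfolding H'_def by blast
    show "y \<in> H'" if "x \<in> H'" "[x = y] (mod q)" for x y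
      using that rep_cong unfolding H'_def by blast
    show "f' x = f' y" if xy: "x \<in> H'" "[x = y] (mod q)" for x y
    proof -
      obtain h j where r: "rep x h j" using xy(1) unfolding H'_def by blast
      show ?thesis using f'[OF r] f'[OF rep_cong[OF r xy(2)]] by simp
    qed
    show "f' (x * y) = f' x * f' y" if xy: "x \<in> H'" "y \<in> H'" for x y
    proof -
      obtain h i h' j where r: "rep x h i" "rep y h' j"
        using xy unfolding H'_def by blast
      then have "h \<in> H" "h' \<in> H" unfolding rep_def by auto
      then show ?thesis
        using f'[OF rep_mult[OF r]] f'[OF r(1)] f'[OF r(2)] f_mult by (simp add: power_add)
    qed
    show "f' 1 = 1" using f'[OF rep_H[OF one_mem]] f_one by simp
  qed
  moreover have "H \<subseteq> H'" using rep_H unfolding H'_def by blast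
  moreover have "g \<in> H'" using rep_g unfolding H'_def by blast
  moreover have "f' g = w" using f'[OF rep_g] f_one by simp
  moreover have "\<forall>x\<in>H. f' x = f x" using f'[OF rep_H] by simp
  ultimately show ?thesis by blast
qed

lemma least_power_mem:
  assumes "coprime g q"
  obtains k where "k > 0" "g ^ k \<in> H" "\<And>l. 0 < l \<Longrightarrow> g ^ l \<in> H \<Longrightarrow> k \<le> l"
proof -
  define P where "P k \<longleftrightarrow> k > 0 \<and> g ^ k \<in> H" for k
  have "P (totient q)"
    using cong_mem[OF one_mem cong_sym[OF euler_theorem[OF assms]]] modulus_pos
    by (simp add: P_def)
  then have "P (Least P)" by (rule LeastI)
  then show ?thesis
    using that[of "Least P"] Least_le[of P] by (simp add: P_def)
qed

end

lemma partial_character_extends: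
  assumes "partial_character q H f"
  shows "\<exists>ch. dirichlet_character q ch \<and> (\<forall>x\<in>H. ch x = f x)"
  using assms
proof (induction "card ({x. x < q \<and> coprime x q} - H)" arbitrary: H f rule: less_induct)
  case less
  interpret partial_character q H f by (rule less.prems)
  show ?case
  proof (cases "{x. x < q \<and> coprime x q} \<subseteq> H")
    case True
    have mem: "x \<in> H \<longleftrightarrow> coprime x q" for x
    proof
      assume "coprime x q"
      then have "x mod q \<in> H"
        using True modulus_pos by auto
      then show "x \<in> H" by (rule cong_mem) simp
    qed (rule coprime_mem)
    have "dirichlet_character q (\<lambda>n. if coprime n q then f n else 0)"
      unfolding dirichlet_character_def
    proof (intro conjI allI)
      fix n
      have c: "[n = n + q] (mod q)" by (simp add: cong_def)
      then have "coprime (n + q) q \<longleftrightarrow> coprime n q"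
        using cong_imp_coprime cong_sym by blast
      then show "(if coprime (n + q) q then f (n + q) else 0) = (if coprime n q then f n else 0)"
        using f_cong[OF _ c] mem[of n] by presburger
      show "((if coprime n q then f n else 0) = 0) = (\<not> coprime n q)"
        using f_nonzero mem by auto
    qed (use f_one f_mult mem in auto)
    then show ?thesis using coprime_mem by (intro exI conjI) auto
  next
    case False
    then obtain g where g: "g < q" "coprime g q" "g \<notin> H" by blast
    obtain k where k: "k > 0" "g ^ k \<in> H" "\<And>l. 0 < l \<Longrightarrow> g ^ l \<in> H \<Longrightarrow> k \<le> l"
      using least_power_mem[OF g(2)] by blast
    obtain w where w: "w ^ k = f (g ^ k)"
      using exists_complex_root[of k "f (g ^ k)"] k(1) by (metis neq0_conv)
    obtain H' f' where H': "partial_character q H' f'" "H \<subseteq> H'" "g \<in> H'"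
      and f': "\<forall>x\<in>H. f' x = f x"
      using extension_step[OF g(2) k w] by blast
    have "card ({x. x < q \<and> coprime x q} - H') < card ({x. x < q \<and> coprime x q} - H)"
      by (rule psubset_card_mono) (use H' g in auto)
    from less.hyps[OF this H'(1)] show ?thesis
      using H'(2) f' by fastforce
  qed
qed

text \<open>Start from the trivial subgroup and send \<open>a\<close>, whose order is at least 2, to a
  primitive root of unity of that order; then extend.\<close>
lemma exists_separating_character:
  assumes q: "q > 0" and a: "coprime a q" "\<not> [a = 1] (mod q)"
  shows "\<exists>ch. dirichlet_character q ch \<and> ch a \<noteq> 1"
proof -
  define H where "H = {x. [x = 1] (mod q)}"
  interpret partial_character q H "\<lambda>_. 1"
  proof
    show "coprime x q" if "x \<in> H" for x
      using that cong_imp_coprime[of 1 x q] by (auto simp: H_def cong_sym)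
    show "x * y \<in> H" if "x \<in> H" "y \<in> H" for x y
      using that cong_mult[of x 1 q y 1] by (simp add: H_def)
    show "y \<in> H" if "x \<in> H" "[x = y] (mod q)" for x y
      using that unfolding H_def by (metis cong_sym cong_trans mem_Collect_eq)
  qed (use q in \<open>auto simp: H_def\<close>)
  obtain k where k: "k > 0" "a ^ k \<in> H" "\<And>l. 0 < l \<Longrightarrow> a ^ l \<in> H \<Longrightarrow> k \<le> l"
    using least_power_mem[OF a(1)] by blast
  have "k \<noteq> 1" using k(2) a(2) by (auto simp: H_def)
  define w where "w = exp (2 * of_real pi * \<i> * of_nat 1 / of_nat k)"
  have "w ^ k = 1"
    unfolding w_def by (rule complex_root_unity) (use k in simp)
  moreover have "w \<noteq> 1"
    unfolding w_def using complex_root_unity_eq_1[of k 1] k \<open>k \<noteq> 1\<close> by simp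
  ultimately obtain H' f' where "partial_character q H' f'" "a \<in> H'" "f' a \<noteq> 1"
    using extension_step[OF a(1) k] by metis
  then show ?thesis
    using partial_character_extends[of q H' f'] by force
qed

section \<open>Lifting residues and the conductor\<close>

lemma dirichlet_character_mult: "dirichlet_character q ch \<Longrightarrow> ch (m * n) = ch m * ch n"
  and dirichlet_character_one: "dirichlet_character q ch \<Longrightarrow> ch 1 = 1"
  and dirichlet_character_eq_0: "dirichlet_character q ch \<Longrightarrow> ch n = 0 \<longleftrightarrow> \<not> coprime n q"
  by (simp_all add: dirichlet_character_def)

lemma dirichlet_character_cong:
  assumes "dirichlet_character q ch" "[m = n] (mod q)"
  shows "ch m = ch n"
  using assms by (metis cong_def dirichlet_character_mod)

lemma dirichlet_character_mult_cnj:
  assumes ch: "dirichlet_character q ch" and q: "q > 0"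
  shows "ch n * cnj (ch n) = (if coprime n q then 1 else 0)"
proof (cases "coprime n q")
  case True
  have "ch n ^ totient q = 1"
    using dirichlet_character_cong[OF ch euler_theorem[OF True]]
    by (simp add: dirichlet_character_power[OF ch] dirichlet_character_one[OF ch, simplified])
  then have "norm (ch n) ^ totient q = 1"
    by (metis norm_one norm_power)
  then have "norm (ch n) = 1"
    using q by (intro power_eq_imp_eq_base[of _ "totient q" 1]) auto
  then show ?thesis
    using True by (simp add: complex_norm_square[symmetric])
next
  case False
  then show ?thesis using dirichlet_character_eq_0[OF ch] by simp
qed

lemma norm_dirichlet_character_le_1:
  assumes ch: "dirichlet_character q ch" and q: "q > 0"
  shows "norm (ch n) \<le> 1"
proof -
  have "norm (ch n) ^ 2 = norm (ch n * cnj (ch n))"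
    by (simp add: norm_mult power2_eq_square)
  also have "\<dots> \<le> 1" by (simp add: dirichlet_character_mult_cnj[OF ch q])
  finally show ?thesis by (simp add: power_le_one_iff)
qed

text \<open>The correcting multiple of \<open>L\<close> is built from the primes dividing \<open>q\<close> but not \<open>x\<close>: every
  prime factor of \<open>q\<close> then divides exactly one of \<open>x\<close> and \<open>t * L\<close>. So each unit modulo \<open>L\<close> is
  represented by a unit modulo \<open>q\<close>.\<close>
lemma coprime_lift:
  fixes x L q :: nat
  assumes "coprime x L" "q > 0"
  obtains y where "[y = x] (mod L)" "coprime y q"
proof -
  define t where "t = \<Prod>{p \<in> prime_factors q. \<not> p dvd x}"
  have t_dvd: "p dvd t \<longleftrightarrow> \<not> p dvd x" if p: "prime p" "p dvd q" for p
  proof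
    assume "p dvd t"
    then obtain r where r: "r \<in> prime_factors q" "\<not> r dvd x" "p dvd r"
      unfolding t_def using prime_dvd_prod_iff[of "{p \<in> prime_factors q. \<not> p dvd x}" p "\<lambda>p. p"] p by auto
    then have "p = r"
      using p primes_dvd_imp_eq by (metis in_prime_factors_imp_prime)
    with r show "\<not> p dvd x" by simp
  next
    assume "\<not> p dvd x"
    then have "p \<in> {p \<in> prime_factors q. \<not> p dvd x}"
      using p assms(2) by (simp add: prime_factors_dvd)
    then show "p dvd t"
      unfolding t_def by (intro dvd_prodI) auto
  qed
  have "coprime (x + t * L) q"
  proof (rule ccontr)
    assume "\<not> coprime (x + t * L) q"
    then obtain c where c: "c dvd x + t * L" "c dvd q" "c \<noteq> 1"
      by (auto elim: not_coprimeE)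
    obtain p where "prime p" "p dvd c" using prime_factor_nat[OF c(3)] by blast
    then have p: "prime p" "p dvd x + t * L" "p dvd q"
      using c by (auto intro: dvd_trans)
    show False
    proof (cases "p dvd x")
      case True
      then have "p dvd t * L" using p(2) by (simp add: dvd_add_right_iff)
      then have "p dvd L" using p t_dvd True by (simp add: prime_dvd_mult_iff)
      then show False using assms(1) True p(1) by (meson coprime_common_divisor not_prime_unit)
    next
      case False
      then have "p dvd t * L" using t_dvd p by simp
      then show False using p(2) False by (simp add: dvd_add_left_iff)
    qed
  qed
  moreover have "[x + t * L = x] (mod L)" by (simp add: cong_def)
  ultimately show ?thesis using that by blast
qed

lemma dirichlet_characters_lift_eq:
  assumes "dirichlet_character d \<psi>" "dirichlet_character d \<theta>" "q > 0"
    and eq: "\<And>n. coprime n q \<Longrightarrow> \<psi> n = \<theta> n"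
  shows "\<psi> = \<theta>"
proof
  fix n
  show "\<psi> n = \<theta> n"
  proof (cases "coprime n d")
    case True
    then obtain y where y: "[y = n] (mod d)" "coprime y q"
      using coprime_lift[OF True \<open>q > 0\<close>] by blast
    then show ?thesis
      using eq dirichlet_character_cong[OF assms(1) y(1)] dirichlet_character_cong[OF assms(2) y(1)]
      by metis
  next
    case False
    then show ?thesis
      using assms(1,2) by (metis dirichlet_character_eq_0)
  qed
qed

lemma chinese_remainder_gcd_nat:
  fixes x y d e :: nat
  assumes "[x = y] (mod (gcd d e))" "d > 0" "e > 0"
  obtains z where "[z = x] (mod d)" "[z = y] (mod e)"
proof -
  have "int (gcd d e) dvd int y - int x"
    using assms(1) by (metis cong_iff_dvd_diff cong_int_iff cong_sym)
  then obtain u where "[int d * u = int y - int x] (mod int e)"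
    using cong_solve_dvd_int[of "int d" "int e" "int y - int x"] by auto
  then have u: "[int x + int d * u = int y] (mod int e)"
    by (metis add.commute cong_add_lcancel diff_add_cancel)
  define z where "z = nat ((int x + int d * u) mod (int d * int e))"
  have z: "[int z = int x + int d * u] (mod (int d * int e))"
    using assms by (simp add: z_def)
  have "[int z = int x] (mod int d)"
    using cong_modulus_mult[OF z] by (simp add: cong_def)
  moreover have "[int z = int y] (mod int e)"
    using z u by (metis cong_modulus_mult cong_trans mult.commute)
  ultimately show ?thesis using that by (simp add: cong_int_iff)
qed

text \<open>Suppose that two characters, modulo \<open>d\<close> and \<open>e\<close>, agree on the units modulo \<open>q\<close>. If
  \<open>x\<close> and \<open>y\<close> are units modulo \<open>q\<close> that agree modulo \<open>gcd d e\<close>, the Chinese remainder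
  theorem provides a unit \<open>w\<close> that is \<open>x\<close> modulo \<open>d\<close> and \<open>y\<close> modulo \<open>e\<close>, and comparing
  both characters at \<open>w\<close> shows that the common values at \<open>x\<close> and \<open>y\<close> are equal. Thus these
  values depend only on the residue modulo \<open>gcd d e\<close>.\<close>
lemma character_induced_from_gcd:
  assumes d: "d dvd q" "dirichlet_character d \<psi>" and e: "e dvd q" "dirichlet_character e \<theta>"
    and q: "q > 0"
    and eq: "\<And>n. coprime n q \<Longrightarrow> \<psi> n = \<theta> n"
  shows "\<exists>\<omega>. dirichlet_character (gcd d e) \<omega> \<and> (\<forall>n. coprime n q \<longrightarrow> \<psi> n = \<omega> n)"
proof -
  define g where "g = gcd d e"
  have pos: "d > 0" "e > 0" using d e q by (auto intro: dvd_pos_nat)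
  have wd: "\<psi> x = \<psi> y" if xy: "coprime x q" "coprime y q" "[x = y] (mod g)" for x y
  proof -
    obtain z where z: "[z = x] (mod d)" "[z = y] (mod e)"
      using chinese_remainder_gcd_nat[OF xy(3)[unfolded g_def] pos] by blast
    have "coprime x d" "coprime y e" using xy d e by (meson coprime_divisors dvd_refl)+
    then have "coprime z d" "coprime z e"
      using z cong_imp_coprime cong_sym by blast+
    then have "coprime z (lcm d e)"
      by (meson coprime_divisors coprime_mult_right_iff dvd_refl lcm_least dvd_triv_left dvd_triv_right)
    then obtain w where w: "[w = z] (mod (lcm d e))" "coprime w q"
      using coprime_lift q by blast
    have wd: "[w = x] (mod d)" and we: "[w = y] (mod e)"
      using w(1) z cong_dvd_modulus_nat cong_trans by (meson dvd_lcm1 dvd_lcm2)+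
    have "\<psi> x = \<psi> w" using dirichlet_character_cong[OF d(2) wd] by simp
    also have "\<dots> = \<theta> w" using eq w by blast
    also have "\<dots> = \<theta> y" using dirichlet_character_cong[OF e(2) we] by simp
    also have "\<dots> = \<psi> y" using eq xy by simp
    finally show ?thesis .
  qed
  \<comment> \<open>Units modulo \<open>gcd d e\<close> need not be coprime to \<open>q\<close>, so \<open>\<omega>\<close> is defined through representatives that are.\<close>
  define lift where "lift n = (SOME y. [y = n] (mod g) \<and> coprime y q)" for n
  have lift: "[lift n = n] (mod g)" "coprime (lift n) q" if n: "coprime n g" for n
  proof -
    have "\<exists>y. [y = n] (mod g) \<and> coprime y q"
      using coprime_lift[OF n q] by metis
    from someI_ex[OF this] show "[lift n = n] (mod g)" "coprime (lift n) q"
      by (simp_all add: lift_def)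
  qed
  have "g dvd q" using d unfolding g_def by (meson dvd_trans gcd_dvd1)
  then have cop: "coprime n g" if "coprime n q" for n
    using that by (meson coprime_divisors dvd_refl)
  define \<omega> where "\<omega> n = (if coprime n g then \<psi> (lift n) else 0)" for n
  have \<omega>: "\<omega> n = \<psi> n" if n: "coprime n q" for n
    using wd[OF lift(2)[OF cop[OF n]] n lift(1)[OF cop[OF n]]] cop[OF n] by (simp add: \<omega>_def)
  have \<omega>_cong: "\<omega> n = \<omega> m" if "[n = m] (mod g)" for m n
  proof (cases "coprime n g")
    case True
    then have m: "coprime m g" using that cong_imp_coprime by blast
    have "[lift n = lift m] (mod g)"
      using lift(1)[OF True] lift(1)[OF m] that by (meson cong_sym cong_trans)
    then show ?thesis
      using wd lift(2) True m by (simp add: \<omega>_def)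
  next
    case False
    then have "\<not> coprime m g" using that cong_imp_coprime cong_sym by blast
    with False show ?thesis by (simp add: \<omega>_def)
  qed
  have "dirichlet_character g \<omega>"
    unfolding dirichlet_character_def
  proof (intro conjI allI)
    show "\<omega> 1 = 1"
      using \<omega>[of 1] dirichlet_character_one[OF d(2)] by simp
    fix n
    show "\<omega> (n + g) = \<omega> n" by (rule \<omega>_cong) (simp add: cong_def)
    have "coprime (lift n) d" if "coprime n g"
      using lift(2)[OF that] d(1) by (meson coprime_divisors dvd_refl)
    then show "\<omega> n = 0 \<longleftrightarrow> \<not> coprime n g"
      using dirichlet_character_eq_0[OF d(2)] by (auto simp: \<omega>_def)
    fix m
    show "\<omega> (n * m) = \<omega> n * \<omega> m"
    proof (cases "coprime n g \<and> coprime m g")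
      case True
      then have "[n * m = lift n * lift m] (mod g)"
        using lift(1) by (intro cong_mult) (auto intro: cong_sym)
      then have "\<omega> (n * m) = \<omega> (lift n * lift m)" by (rule \<omega>_cong)
      also have "\<dots> = \<psi> (lift n * lift m)"
        using True lift(2) by (intro \<omega>) simp
      finally show ?thesis
        using True by (simp add: dirichlet_character_mult[OF d(2)] \<omega>_def)
    next
      case False
      then show ?thesis by (auto simp: \<omega>_def)
    qed
  qed
  then show ?thesis using \<omega> unfolding g_def by metis
qed

text \<open>Both characters come from modulus \<open>gcd d e\<close>, and primitivity forces this modulus
  to be \<open>d\<close> as well as \<open>e\<close>.\<close>
lemma primitive_characters_lift_unique:
  assumes d: "d dvd q" "primitive_character d \<psi>" and e: "e dvd q" "primitive_character e \<theta>"
    and q: "q > 0"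
    and eq: "\<And>n. coprime n q \<Longrightarrow> \<psi> n = \<theta> n"
  shows "d = e" "\<psi> = \<theta>"
proof -
  have ch: "dirichlet_character d \<psi>" "dirichlet_character e \<theta>"
    using d e by (auto simp: primitive_character_def)
  have pos: "d > 0" "e > 0" using d e q by (auto intro: dvd_pos_nat)
  obtain \<omega> where \<omega>: "dirichlet_character (gcd d e) \<omega>" "\<And>n. coprime n q \<Longrightarrow> \<psi> n = \<omega> n"
    using character_induced_from_gcd[OF d(1) ch(1) e(1) ch(2) q eq] by blast
  have full: "gcd d e = c"
    if c: "primitive_character c \<eta>" "gcd d e dvd c" "c > 0"
      and eta: "\<And>n. coprime n q \<Longrightarrow> \<eta> n = \<omega> n" for c \<eta>
  proof (rule ccontr)
    assume "gcd d e \<noteq> c"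
    then have less: "gcd d e < c" using c dvd_imp_le le_neq_implies_less by blast
    have chc: "dirichlet_character c \<eta>" using c(1) by (simp add: primitive_character_def)
    have "\<eta> n = \<omega> n" if n: "coprime n c" for n
    proof -
      obtain y where y: "[y = n] (mod c)" "coprime y q"
        using coprime_lift[OF n q] by blast
      have "\<eta> n = \<eta> y" using dirichlet_character_cong[OF chc y(1)] by simp
      also have "\<dots> = \<omega> y" using eta y by simp
      also have "\<dots> = \<omega> n"
        by (rule dirichlet_character_cong[OF \<omega>(1) cong_dvd_modulus_nat[OF y(1) c(2)]])
      finally show ?thesis .
    qed
    then show False
      using c less \<omega>(1) unfolding primitive_character_def by blast
  qed
  have "gcd d e = d" using full[OF d(2)] pos \<omega>(2) by simp
  moreover have "gcd d e = e" using full[OF e(2)] pos \<omega>(2) eq by simp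
  ultimately show "d = e" by simp
  then show "\<psi> = \<theta>"
    using dirichlet_characters_lift_eq[OF ch(1) _ q eq] ch by simp
qed

lemma induced_character:
  assumes d: "d dvd q" "dirichlet_character d \<psi>"
  shows "dirichlet_character q (\<lambda>n. if coprime n q then \<psi> n else 0)"
proof -
  have "coprime (n + q) q \<longleftrightarrow> coprime n q" for n
    using cong_imp_coprime[of n "n + q" q] cong_imp_coprime[of "n + q" n q]
    by (auto simp: cong_def)
  moreover have "\<psi> (n + q) = \<psi> n" for n
    using d by (intro dirichlet_character_cong[OF d(2)]) (auto simp: cong_def mod_add_eq)
  moreover have "\<psi> n \<noteq> 0" if "coprime n q" for n
    using that d by (meson coprime_divisors dirichlet_character_eq_0 dvd_refl)
  ultimately show ?thesis
    using d(2) unfolding dirichlet_character_def by auto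
qed

text \<open>Take the least modulus from which \<open>ch\<close> is induced.\<close>
lemma exists_inducing_primitive_character:
  assumes ch: "dirichlet_character q ch" and q: "q > 0"
  obtains d \<psi> where "d dvd q" "primitive_character d \<psi>"
    "ch = (\<lambda>n. if coprime n q then \<psi> n else 0)"
proof -
  define P where "P d \<longleftrightarrow> d dvd q \<and>
    (\<exists>\<psi>. dirichlet_character d \<psi> \<and> (\<forall>n. coprime n q \<longrightarrow> ch n = \<psi> n))" for d
  define d where "d = Least P"
  have "P q" unfolding P_def using ch by (intro conjI exI[of _ ch]) auto
  then have "P d" unfolding d_def by (rule LeastI)
  then obtain \<psi> where \<psi>: "d dvd q" "dirichlet_character d \<psi>" "\<And>n. coprime n q \<Longrightarrow> ch n = \<psi> n"
    unfolding P_def by blast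
  have "\<not> (\<exists>e \<theta>. e dvd d \<and> e < d \<and> dirichlet_character e \<theta> \<and> (\<forall>n. coprime n d \<longrightarrow> \<psi> n = \<theta> n))"
  proof
    assume "\<exists>e \<theta>. e dvd d \<and> e < d \<and> dirichlet_character e \<theta> \<and> (\<forall>n. coprime n d \<longrightarrow> \<psi> n = \<theta> n)"
    then obtain e \<theta> where e: "e dvd d" "e < d" "dirichlet_character e \<theta>"
      "\<And>n. coprime n d \<Longrightarrow> \<psi> n = \<theta> n" by blast
    have "P e"
      unfolding P_def using e \<psi> by (metis coprime_divisors dvd_refl dvd_trans)
    then show False using not_less_Least[of e P] e(2) unfolding d_def by blast
  qed
  then have "primitive_character d \<psi>" using \<psi>(2) by (simp add: primitive_character_def)
  moreover have "ch = (\<lambda>n. if coprime n q then \<psi> n else 0)"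
    using \<psi>(3) dirichlet_character_eq_0[OF ch] by auto
  ultimately show ?thesis using that \<psi>(1) by blast
qed

lemma bij_betw_inducing_primitive_character:
  assumes q: "q > 0"
  shows "bij_betw (\<lambda>(d, \<psi>) n. if coprime n q then \<psi> n else 0)
    (SIGMA d:{d. d dvd q}. {\<psi>. primitive_character d \<psi>}) {ch. dirichlet_character q ch}"
    (is "bij_betw ?I ?S ?D")
  unfolding bij_betw_def
proof
  show "inj_on ?I ?S"
  proof (rule inj_onI, clarify)
    fix d \<psi> e \<theta>
    assume a: "d dvd q" "primitive_character d \<psi>" "e dvd q" "primitive_character e \<theta>"
      and "(\<lambda>n. if coprime n q then \<psi> n else 0) = (\<lambda>n. if coprime n q then \<theta> n else 0)"
    then have "\<psi> n = \<theta> n" if "coprime n q" for n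
      using that by (metis (full_types))
    then show "d = e \<and> \<psi> = \<theta>"
      using primitive_characters_lift_unique[OF a q] by blast
  qed
  show "?I ` ?S = ?D"
  proof
    show "?I ` ?S \<subseteq> ?D"
      using induced_character by (auto simp: primitive_character_def)
    show "?D \<subseteq> ?I ` ?S"
    proof
      fix ch assume "ch \<in> ?D"
      then obtain d \<psi> where "d dvd q" "primitive_character d \<psi>"
        "ch = (\<lambda>n. if coprime n q then \<psi> n else 0)"
        using exists_inducing_primitive_character q by blast
      then show "ch \<in> ?I ` ?S" by (intro image_eqI[of _ _ "(d, \<psi>)"]) auto
    qed
  qed
qed

lemma finite_dirichlet_characters:
  assumes q: "q > 0"
  shows "finite {ch. dirichlet_character q ch}"
proof -
  have "finite (SIGMA d:{d. d dvd q}. {\<psi>. primitive_character d \<psi>})"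
    using q by (intro finite_SigmaI finite_divisors_nat finite_primitive_characters)
      (auto simp: Suc_le_eq intro: dvd_pos_nat)
  then show ?thesis
    using bij_betw_finite[OF bij_betw_inducing_primitive_character[OF q]] by blast
qed

lemma sum_characters_by_conductor:
  assumes q: "q > 0" and m: "coprime m q" and n: "coprime n q"
  shows "(\<Sum>ch | dirichlet_character q ch. ch m * cnj (ch n)) =
    (\<Sum>d | d dvd q. \<Sum>ch | primitive_character d ch. ch m * cnj (ch n))"
proof -
  have "(\<Sum>ch | dirichlet_character q ch. ch m * cnj (ch n)) =
     (\<Sum>(d, \<psi>)\<in>(SIGMA d:{d. d dvd q}. {\<psi>. primitive_character d \<psi>}). \<psi> m * cnj (\<psi> n))"
    using m n by (subst sum.reindex_bij_betw[OF bij_betw_inducing_primitive_character[OF q], symmetric])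
      (auto intro!: sum.cong)
  also have "\<dots> = (\<Sum>d | d dvd q. \<Sum>ch | primitive_character d ch. ch m * cnj (ch n))"
    using q by (intro sum.Sigma[symmetric] finite_divisors_nat ballI finite_primitive_characters)
      (auto simp: Suc_le_eq intro: dvd_pos_nat)
  finally show ?thesis .
qed

section \<open>Orthogonality\<close>

text \<open>Multiplication by a character \<open>\<psi>\<close> with \<open>\<psi> a \<noteq> 1\<close> permutes the characters and
  multiplies the sum by \<open>\<psi> a\<close>.\<close>
lemma sum_dirichlet_characters_eq_0:
  assumes q: "q > 0" and a: "coprime a q" "\<not> [a = 1] (mod q)"
  shows "(\<Sum>ch | dirichlet_character q ch. ch a) = 0"
proof -
  let ?D = "{ch. dirichlet_character q ch}"
  obtain \<psi> where \<psi>: "dirichlet_character q \<psi>" "\<psi> a \<noteq> 1"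
    using exists_separating_character[OF q a] by blast
  have mult: "dirichlet_character q (\<lambda>n. ch n * \<psi> n)"
    and mult_cnj: "dirichlet_character q (\<lambda>n. ch n * cnj (\<psi> n))" if "dirichlet_character q ch" for ch
    using that \<psi>(1) unfolding dirichlet_character_def by auto
  have cancel: "ch n * \<psi> n * cnj (\<psi> n) = ch n" if "dirichlet_character q ch" for ch n
    using dirichlet_character_mult_cnj[OF \<psi>(1) q, of n] dirichlet_character_eq_0[OF that, of n]
    by (simp add: mult.assoc)
  have "(\<Sum>ch\<in>?D. ch a) = (\<Sum>ch\<in>?D. ch a * \<psi> a)"
    by (rule sum.reindex_bij_witness[of _ "\<lambda>ch n. ch n * \<psi> n" "\<lambda>ch n. ch n * cnj (\<psi> n)"])
      (use mult mult_cnj cancel in \<open>auto simp: mult.assoc mult.commute[of "cnj _"]\<close>)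
  also have "\<dots> = \<psi> a * (\<Sum>ch\<in>?D. ch a)" by (simp add: sum_distrib_left mult.commute)
  finally have "(\<psi> a - 1) * (\<Sum>ch\<in>?D. ch a) = 0" by (simp add: algebra_simps)
  then show ?thesis using \<psi>(2) by simp
qed

text \<open>Multiplication by \<open>b\<close> permutes the residues and multiplies the sum by \<open>ch b\<close>.\<close>
lemma sum_dirichlet_character_eq_0:
  assumes ch: "dirichlet_character q ch" and q: "q > 0" and b: "coprime b q" "ch b \<noteq> 1"
  shows "(\<Sum>n<q. ch n) = 0"
proof -
  have "inj_on (\<lambda>n. b * n mod q) {..<q}"
  proof (rule inj_onI)
    fix x y assume xy: "x \<in> {..<q}" "y \<in> {..<q}" "b * x mod q = b * y mod q"
    then have "[b * x = b * y] (mod q)" by (simp add: cong_def)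
    then have "[x = y] (mod q)" using b(1) by (simp add: cong_mult_lcancel_nat)
    then show "x = y" using xy by (simp add: cong_def)
  qed
  then have bij: "bij_betw (\<lambda>n. b * n mod q) {..<q} {..<q}"
    using q by (intro bij_betw_imageI endo_inj_surj) auto
  have "(\<Sum>n<q. ch n) = (\<Sum>n<q. ch (b * n mod q))"
    by (rule sum.reindex_bij_betw[OF bij, symmetric])
  also have "\<dots> = ch b * (\<Sum>n<q. ch n)"
    by (simp add: dirichlet_character_mod[OF ch] dirichlet_character_mult[OF ch] sum_distrib_left)
  finally have "(ch b - 1) * (\<Sum>n<q. ch n) = 0" by (simp add: algebra_simps)
  then show ?thesis using b(2) by simp
qed

text \<open>Sum all values \<open>ch n\<close> with \<open>n < q\<close> in two ways: by columns only \<open>n = 1\<close> contributes,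
  and gives the number of characters; by rows only the principal character contributes, at
  most \<open>q\<close>.\<close>
lemma card_dirichlet_characters_le:
  assumes q: "q > 0"
  shows "card {ch. dirichlet_character q ch} \<le> q"
proof -
  let ?D = "{ch. dirichlet_character q ch}"
  define ch0 where "ch0 n = (if coprime n q then 1 else 0 :: complex)" for n
  have fin: "finite ?D" by (rule finite_dirichlet_characters[OF q])
  \<comment> \<open>The column is written \<open>1 mod q\<close> because for \<open>q = 1\<close> it is the column \<open>n = 0\<close>.\<close>
  have column: "(\<Sum>ch\<in>?D. ch n) = (if n = 1 mod q then of_nat (card ?D) else 0)" if "n < q" for n
  proof (cases "coprime n q")
    case True
    have "n = 1 mod q \<longleftrightarrow> [n = 1] (mod q)" using that by (simp add: cong_def)
    moreover have "(\<Sum>ch\<in>?D. ch n) = of_nat (card ?D)" if n1: "[n = 1] (mod q)"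
    proof -
      have "(\<Sum>ch\<in>?D. ch n) = (\<Sum>ch\<in>?D. 1)"
      proof (intro sum.cong refl)
        fix ch assume "ch \<in> ?D"
        then have ch: "dirichlet_character q ch" by simp
        show "ch n = 1"
          using dirichlet_character_cong[OF ch n1] dirichlet_character_one[OF ch] by simp
      qed
      then show ?thesis by simp
    qed
    ultimately show ?thesis using sum_dirichlet_characters_eq_0[OF q True] by simp
  next
    case False
    have "coprime (1 mod q) q" using q by simp
    then show ?thesis using False dirichlet_character_eq_0 by (auto intro!: sum.neutral)
  qed
  have row: "(\<Sum>n<q. ch n) = 0" if "ch \<in> ?D" "ch \<noteq> ch0" for ch
  proof -
    have ch: "dirichlet_character q ch" using that by simp
    have "\<exists>b. coprime b q \<and> ch b \<noteq> 1"
    proof (rule ccontr)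
      assume "\<not> ?thesis"
      then have "ch = ch0" using dirichlet_character_eq_0[OF ch] by (auto simp: ch0_def)
      with that show False by simp
    qed
    then show ?thesis using sum_dirichlet_character_eq_0[OF ch q] by blast
  qed
  have "of_nat (card ?D) = (\<Sum>n<q. \<Sum>ch\<in>?D. ch n)"
    using q by (simp add: column)
  also have "\<dots> = (\<Sum>ch\<in>?D. \<Sum>n<q. ch n)" by (rule sum.swap)
  also have "\<dots> = (\<Sum>ch\<in>?D. if ch = ch0 then \<Sum>n<q. ch0 n else 0)"
    using row by (intro sum.cong) auto
  also have "norm \<dots> \<le> (\<Sum>n<q. norm (ch0 n))"
    using fin by (simp add: norm_sum sum_nonneg)
  also have "\<dots> \<le> (\<Sum>n<q. 1)" by (intro sum_mono) (simp add: ch0_def)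
  finally show ?thesis by simp
qed

lemma norm_sum_dirichlet_characters_le:
  assumes q: "q > 0" and m: "coprime m q" and n: "coprime n q"
  shows "norm (\<Sum>ch | dirichlet_character q ch. ch m * cnj (ch n)) \<le> (if [m = n] (mod q) then real q else 0)"
proof (cases "[m = n] (mod q)")
  case True
  let ?D = "{ch. dirichlet_character q ch}"
  have "norm (\<Sum>ch\<in>?D. ch m * cnj (ch n)) \<le> (\<Sum>ch\<in>?D. norm (ch m * cnj (ch n)))"
    by (rule norm_sum)
  also have "\<dots> \<le> (\<Sum>ch\<in>?D. 1)"
    using norm_dirichlet_character_le_1[OF _ q]
    by (intro sum_mono) (simp add: norm_mult mult_le_one)
  also have "\<dots> \<le> real q"
    using card_dirichlet_characters_le[OF q] by simp
  finally show ?thesis using True by simp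
next
  case False
  \<comment> \<open>Modulo \<open>q\<close>, this is the quotient of \<open>m\<close> by \<open>n\<close>.\<close>
  define a where "a = m * n ^ (totient q - 1)"
  have "a * n = m * n ^ totient q"
    using q by (cases "totient q") (auto simp: a_def algebra_simps)
  also have "[m * n ^ totient q = m * 1] (mod q)"
    by (intro cong_mult cong_refl euler_theorem n)
  finally have an: "[a * n = m] (mod q)" by simp
  have a: "coprime a q" using m n by (simp add: a_def)
  have "\<not> [a = 1] (mod q)"
  proof
    assume "[a = 1] (mod q)"
    then have "[a * n = 1 * n] (mod q)" by (intro cong_mult cong_refl)
    then have "[m = n] (mod q)" using an by (simp add: cong_def)
    then show False using False by simp
  qed
  have "ch m * cnj (ch n) = ch a" if "dirichlet_character q ch" for ch
    using dirichlet_character_cong[OF that an] dirichlet_character_mult[OF that, of a n]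
      dirichlet_character_mult_cnj[OF that q, of n] n by (metis (full_types) mult.assoc mult.right_neutral)
  then have "(\<Sum>ch | dirichlet_character q ch. ch m * cnj (ch n)) = (\<Sum>ch | dirichlet_character q ch. ch a)"
    by simp
  then show ?thesis
    using sum_dirichlet_characters_eq_0[OF q a \<open>\<not> [a = 1] (mod q)\<close>] False by simp
qed

section \<open>Moebius inversion and primitive characters\<close>

definition moebius :: "nat \<Rightarrow> int" where
  "moebius n = (if squarefree n then (-1) ^ card (prime_factors n) else 0)"

lemma abs_moebius_le_1: "\<bar>moebius n\<bar> \<le> 1"
  by (simp add: moebius_def)

lemma moebius_prime_mult:
  assumes p: "prime p" and n: "n > 0"
  shows "moebius (p * n) = (if p dvd n then 0 else - moebius n)"
proof (cases "p dvd n")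
  case True
  then have "p ^ 2 dvd p * n" by (auto simp: power2_eq_square)
  then have "\<not> squarefree (p * n)"
    using p by (metis not_prime_unit squarefreeD)
  then show ?thesis using True by (simp add: moebius_def)
next
  case False
  then have "coprime p n" using p by (simp add: prime_imp_coprime)
  then have "squarefree (p * n) \<longleftrightarrow> squarefree n"
    using p squarefree_mult_coprime squarefree_prime squarefree_multD(2) by blast
  moreover have "prime_factors (p * n) = insert p (prime_factors n)"
    using p n by (auto simp: prime_factors_product prime_prime_factors)
  moreover have "p \<notin> prime_factors n" using False by auto
  ultimately show ?thesis using False by (simp add: moebius_def)
qed

text \<open>For a prime \<open>p\<close> dividing \<open>n\<close>, the divisors \<open>d\<close> prime to \<open>p\<close> cancel against the
  divisors \<open>p * d\<close>; all other divisors are divisible by \<open>p\<close> twice.\<close>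
lemma sum_moebius_divisors:
  assumes n: "n > 0"
  shows "(\<Sum>d | d dvd n. moebius d) = (if n = 1 then 1 else 0)"
proof (cases "n = 1")
  case True
  then show ?thesis by (simp add: moebius_def)
next
  case False
  then obtain p where p: "prime p" "p dvd n" using prime_factor_nat by blast
  let ?A = "{d. d dvd n \<and> \<not> p dvd d}" and ?B = "{d. d dvd n \<and> p dvd d}"
  have fin: "finite {d. d dvd n}" using n by simp
  have "(\<Sum>d\<in>?B. moebius d) = (\<Sum>d\<in>(*) p ` ?A. moebius d)"
  proof (rule sum.mono_neutral_right)
    show "finite ?B" using fin by (rule rev_finite_subset) auto
    have "p * d dvd n" if "d dvd n" "\<not> p dvd d" for d
      by (intro divides_mult prime_imp_coprime p that)
    then show "(*) p ` ?A \<subseteq> ?B" by (intro image_subsetI) simp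
    show "\<forall>d\<in>?B - (*) p ` ?A. moebius d = 0"
    proof
      fix d assume d: "d \<in> ?B - (*) p ` ?A"
      then obtain e where e: "d = p * e" by auto
      have "e dvd n" using d e by (auto intro: dvd_mult_right)
      then have "p dvd e" using d e by auto
      moreover have "e > 0" using \<open>e dvd n\<close> n by (auto intro: dvd_pos_nat)
      ultimately show "moebius d = 0" using moebius_prime_mult[OF p(1)] e by simp
    qed
  qed
  also have "\<dots> = (\<Sum>d\<in>?A. moebius (p * d))"
    using p by (subst sum.reindex) (auto simp: inj_on_def prime_gt_0_nat)
  also have "\<dots> = (\<Sum>d\<in>?A. - moebius d)"
    using moebius_prime_mult[OF p(1)] n by (intro sum.cong) (auto intro: dvd_pos_nat)
  finally have "(\<Sum>d\<in>?A. moebius d) + (\<Sum>d\<in>?B. moebius d) = 0"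
    by (simp add: sum_negf)
  moreover have "(\<Sum>d | d dvd n. moebius d) = (\<Sum>d\<in>?A. moebius d) + (\<Sum>d\<in>?B. moebius d)"
    using fin by (subst sum.union_disjoint[symmetric]) (auto intro!: sum.cong elim: rev_finite_subset)
  ultimately show ?thesis using False by simp
qed

lemma moebius_inversion:
  fixes P T :: "nat \<Rightarrow> complex"
  assumes q: "q > 0" and T: "\<And>d. d dvd q \<Longrightarrow> T d = (\<Sum>e | e dvd d. P e)"
  shows "P q = (\<Sum>d | d dvd q. of_int (moebius (q div d)) * T d)"
proof -
  have fin: "finite {d. d dvd q}" using q by simp
  have inner: "(\<Sum>d | d dvd q \<and> e dvd d. of_int (moebius (q div d))) = (if e = q then 1 else 0 :: complex)"
    if e: "e dvd q" for e
  proof -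
    have e0: "e > 0" using e q by (auto intro: dvd_pos_nat)
    have qe: "q div e > 0" using e q by (auto elim!: dvdE)
    have "(\<Sum>d | d dvd q \<and> e dvd d. moebius (q div d)) = (\<Sum>d | d dvd q div e. moebius d)"
    proof (rule sum.reindex_bij_witness[of _ "\<lambda>d. q div d" "\<lambda>d. q div d"])
      fix d assume "d \<in> {d. d dvd q \<and> e dvd d}"
      then obtain f g where "d = e * f" "q = d * g" by (auto elim!: dvdE)
      then show "q div (q div d) = d" "q div d \<in> {d. d dvd q div e}"
        "moebius (q div d) = moebius (q div d)"
        using q by (auto simp: mult.assoc)
    next
      fix d assume "d \<in> {d. d dvd q div e}"
      then obtain f where "q div e = d * f" by (auto elim!: dvdE)
      then have "q = e * (d * f)" using e by (metis dvd_mult_div_cancel)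
      then have "q = d * (e * f)" by (simp add: mult_ac)
      then show "q div (q div d) = d" "q div d \<in> {d. d dvd q \<and> e dvd d}"
        using q by auto
    qed
    also have "\<dots> = (if e = q then 1 else 0)"
      using sum_moebius_divisors[OF qe] e e0 by (auto elim!: dvdE)
    finally have "of_int (\<Sum>d | d dvd q \<and> e dvd d. moebius (q div d)) = (of_int (if e = q then 1 else 0) :: complex)"
      by (rule arg_cong)
    then show ?thesis by (simp split: if_splits)
  qed
  have "(\<Sum>d | d dvd q. of_int (moebius (q div d)) * T d) =
      (\<Sum>d | d dvd q. \<Sum>e | e dvd q \<and> e dvd d. of_int (moebius (q div d)) * P e)"
  proof (intro sum.cong refl)
    fix d assume d: "d \<in> {d. d dvd q}"
    then have "{e. e dvd d} = {e. e dvd q \<and> e dvd d}" by (auto intro: dvd_trans)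
    then show "of_int (moebius (q div d)) * T d =
        (\<Sum>e | e dvd q \<and> e dvd d. of_int (moebius (q div d)) * P e)"
      using T d by (simp add: sum_distrib_left)
  qed
  also have "\<dots> = (\<Sum>e | e dvd q. \<Sum>d | d dvd q \<and> e dvd d. of_int (moebius (q div d)) * P e)"
    using sum.swap_restrict[OF fin fin, of "\<lambda>d e. of_int (moebius (q div d)) * P e" "\<lambda>d e. e dvd d"]
    by simp
  also have "\<dots> = (\<Sum>e | e dvd q. if e = q then P e else 0)"
    using inner by (intro sum.cong) (auto simp: sum_distrib_right[symmetric])
  also have "\<dots> = P q" using fin by simp
  finally show ?thesis by simp
qed

text \<open>By Moebius inversion the primitive sum is a combination, with coefficients 0, 1
  and -1, of the complete sums modulo the divisors of \<open>q\<close>, to each of which orthogonality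
  applies.\<close>
lemma norm_sum_primitive_characters_le:
  assumes q: "q > 0"
  shows "norm (\<Sum>ch | primitive_character q ch. ch m * cnj (ch n)) \<le>
    (\<Sum>d | d dvd q \<and> [m = n] (mod d). real d)"
proof (cases "coprime m q \<and> coprime n q")
  case False
  have "(\<Sum>ch | primitive_character q ch. ch m * cnj (ch n)) = 0"
    using False dirichlet_character_eq_0
    by (intro sum.neutral) (auto simp: primitive_character_def)
  then show ?thesis by (simp add: sum_nonneg)
next
  case True
  define T where "T d = (\<Sum>ch | dirichlet_character d ch. ch m * cnj (ch n))" for d
  have fin: "finite {d. d dvd q}" using q by simp
  have d: "d > 0" "coprime m d" "coprime n d" if "d dvd q" for d
    using that True q by (auto intro: dvd_pos_nat)
  have "(\<Sum>ch | primitive_character q ch. ch m * cnj (ch n)) =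
      (\<Sum>d | d dvd q. of_int (moebius (q div d)) * T d)"
    by (rule moebius_inversion[OF q]) (simp add: T_def sum_characters_by_conductor d)
  also have "norm \<dots> \<le> (\<Sum>d | d dvd q. norm (of_int (moebius (q div d)) * T d))"
    by (rule norm_sum)
  also have "\<dots> \<le> (\<Sum>d | d dvd q. if [m = n] (mod d) then real d else 0)"
  proof (intro sum_mono)
    fix e assume "e \<in> {d. d dvd q}"
    then have "norm (T e) \<le> (if [m = n] (mod e) then real e else 0)"
      unfolding T_def using d by (intro norm_sum_dirichlet_characters_le) auto
    moreover have "norm (of_int (moebius (q div e)) :: complex) \<le> 1"
      using abs_moebius_le_1[of "q div e"] by (simp only: norm_of_int)
    ultimately show "norm (of_int (moebius (q div e)) * T e) \<le> (if [m = n] (mod e) then real e else 0)"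
      unfolding norm_mult by (meson mult_left_le_one_le norm_ge_zero order_trans)
  qed
  also have "\<dots> = (\<Sum>d | d dvd q \<and> [m = n] (mod d). real d)"
    using fin by (simp add: sum.If_cases Int_def)
  finally show ?thesis .
qed

section \<open>The divisor bound\<close>

lemma divisor_tau_mult_le:
  assumes "a > 0" "b > 0"
  shows "divisor_tau (a * b) \<le> divisor_tau a * divisor_tau b"
proof -
  let ?P = "{d. d dvd a} \<times> {d. d dvd b}"
  have fin: "finite ?P" using assms by simp
  have "{d. d dvd a * b} \<subseteq> (\<lambda>(d, e). d * e) ` ?P"
  proof
    fix x assume "x \<in> {d. d dvd a * b}"
    then obtain d e where "x = d * e" "d dvd a" "e dvd b"
      using division_decomp[of x a b] by blast
    then show "x \<in> (\<lambda>(d, e). d * e) ` ?P"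
      by (intro image_eqI[of _ _ "(d, e)"]) auto
  qed
  then have "card {d. d dvd a * b} \<le> card ?P"
    using card_image_le[OF fin] card_mono[OF finite_imageI[OF fin]] le_trans by blast
  then show ?thesis by (simp add: divisor_tau_def card_cartesian_product)
qed

lemma divisor_tau_prime_power_le:
  assumes "prime p"
  shows "divisor_tau (p ^ k) \<le> k + 1"
proof -
  have "{d. d dvd p ^ k} \<subseteq> (\<lambda>i. p ^ i) ` {..k}"
    using divides_primepow_nat[OF assms] by auto
  then have "card {d. d dvd p ^ k} \<le> card {..k}"
    using card_image_le[of "{..k}"] card_mono[of "(\<lambda>i. p ^ i) ` {..k}"] le_trans by blast
  then show ?thesis by (simp add: divisor_tau_def)
qed

text \<open>Compare \<open>k + 1\<close>, the number of divisors of \<open>p ^ k\<close>, with \<open>(p ^ k) powr \<eta>\<close>. If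
  \<open>p powr \<eta> \<ge> 2\<close>, then \<open>k + 1 \<le> 2 ^ k\<close> is the smaller one. Each of the finitely many
  remaining primes, which form the set \<open>S\<close>, costs a factor \<open>c\<close> that does not depend on \<open>k\<close>,
  so the product of these factors is at most \<open>c ^ card S\<close>.\<close>
lemma divisor_bound:
  fixes \<eta> :: real
  assumes "\<eta> > 0"
  shows "\<exists>C\<ge>1. \<forall>n\<ge>1. real (divisor_tau n) \<le> C * real n powr \<eta>"
proof -
  \<comment> \<open>With \<open>x = \<eta> * k * ln 2\<close>, this makes \<open>k + 1 \<le> c * (1 + x) \<le> c * exp x = c * (2 ^ k) powr \<eta>\<close>.\<close>
  define c where "c = 1 + 1 / (\<eta> * ln 2)"
  define S where "S = {p::nat. real p < 2 powr (1 / \<eta>)}"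
  have c1: "c \<ge> 1" using assms by (simp add: c_def)
  have finS: "finite S"
  proof -
    have "S \<subseteq> {..nat \<lceil>2 powr (1 / \<eta>)\<rceil>}"
      unfolding S_def by (auto simp: le_nat_iff) linarith
    then show ?thesis by (rule finite_subset) simp
  qed
  have small: "real (k + 1) \<le> c * real (p ^ k) powr \<eta>" if "prime p" for p k :: nat
  proof -
    have "real (k + 1) \<le> c * (1 + \<eta> * real k * ln 2)"
    proof -
      have "c * (1 + \<eta> * real k * ln 2) = 1 + \<eta> * real k * ln 2 + 1 / (\<eta> * ln 2) + real k"
        using assms by (simp add: c_def field_simps)
      moreover have "0 \<le> \<eta> * real k * ln 2" "0 \<le> 1 / (\<eta> * ln 2)" using assms by auto
      ultimately show ?thesis by simp
    qed
    also have "\<dots> \<le> c * exp (\<eta> * real k * ln 2)"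
      using c1 exp_ge_add_one_self by (intro mult_left_mono) auto
    also have "exp (\<eta> * real k * ln 2) = (2 ^ k) powr \<eta>"
      by (simp add: powr_def ln_realpow mult_ac)
    also have "(2 ^ k) powr \<eta> \<le> real (p ^ k) powr \<eta>"
      using assms prime_ge_2_nat[OF that] by (intro powr_mono2) (auto intro: power_mono)
    finally show ?thesis using c1 by simp
  qed
  have large: "real (k + 1) \<le> real (p ^ k) powr \<eta>" if "p \<notin> S" for p k :: nat
  proof -
    have "2 powr (1 / \<eta>) \<le> real p" using that by (simp add: S_def)
    then have "(2 powr (1 / \<eta>)) powr \<eta> \<le> real p powr \<eta>" using assms by (intro powr_mono2) auto
    then have p2: "2 \<le> real p powr \<eta>" using assms by (simp add: powr_powr)
    have p0: "real p > 0" using \<open>2 powr (1 / \<eta>) \<le> real p\<close> by (smt (verit) powr_gt_zero)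
    have "real (k + 1) \<le> 2 ^ k" by (induction k) auto
    also have "\<dots> \<le> (real p powr \<eta>) ^ k" by (intro power_mono p2) simp
    also have "\<dots> = real (p ^ k) powr \<eta>"
      using p0 by (simp add: powr_realpow[symmetric] powr_powr mult.commute)
    finally show ?thesis .
  qed
  have main: "real (divisor_tau n) \<le> c ^ card (prime_factors n \<inter> S) * real n powr \<eta>" if "n > 0" for n
    using that
  proof (induction n rule: less_induct)
    case (less n)
    show ?case
    proof (cases "n = 1")
      case True
      then show ?thesis by (simp add: divisor_tau_def)
    next
      case False
      then obtain p where p: "prime p" "p dvd n" using prime_factor_nat by blast
      have "\<not> is_unit p" using p by (metis not_prime_unit)
      with less.prems obtain m where m: "n = p ^ multiplicity p n * m" "\<not> p dvd m"
        using multiplicity_decompose'[of n p] by blast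
      define k where "k = multiplicity p n"
      have nk: "n = p ^ k * m" using m k_def by simp
      have m0: "m > 0" using less.prems nk by (intro Nat.gr0I) simp
      have k0: "k \<noteq> 0" using p m nk by (intro notI) simp
      have mn: "m < n" using m0 k0 nk one_less_power[OF prime_gt_1_nat[OF p(1)], of k] by simp
      have pf: "prime_factors n = insert p (prime_factors m)"
        using nk m0 p(1) k0 by (auto simp: prime_factors_product prime_factors_power prime_prime_factors)
      have pnot: "p \<notin> prime_factors m" using m by auto
      have IH: "real (divisor_tau m) \<le> c ^ card (prime_factors m \<inter> S) * real m powr \<eta>"
        by (rule less.IH[OF mn m0])
      have step: "real (k + 1) * c ^ card (prime_factors m \<inter> S)
          \<le> c ^ card (prime_factors n \<inter> S) * real (p ^ k) powr \<eta>"
      proof (cases "p \<in> S")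
        case True
        then have "card (prime_factors n \<inter> S) = Suc (card (prime_factors m \<inter> S))"
          using pf pnot by simp
        then show ?thesis
          using mult_right_mono[OF small[OF p(1), of k], of "c ^ card (prime_factors m \<inter> S)"] c1
          by (simp add: mult_ac)
      next
        case False
        then have "card (prime_factors n \<inter> S) = card (prime_factors m \<inter> S)"
          using pf by simp
        then show ?thesis
          using mult_right_mono[OF large[OF False, of k], of "c ^ card (prime_factors m \<inter> S)"] c1
          by (simp add: mult_ac)
      qed
      have "divisor_tau n \<le> (k + 1) * divisor_tau m"
        using divisor_tau_mult_le[of "p ^ k" m] divisor_tau_prime_power_le[OF p(1), of k] m0
          prime_gt_0_nat[OF p(1)] unfolding nk by (meson le_trans mult_le_mono1 zero_less_power)
      then have "real (divisor_tau n) \<le> real ((k + 1) * divisor_tau m)" by (rule of_nat_mono)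
      also have "\<dots> = real (k + 1) * real (divisor_tau m)" by (rule of_nat_mult)
      also have "\<dots> \<le> real (k + 1) * (c ^ card (prime_factors m \<inter> S) * real m powr \<eta>)"
        by (intro mult_left_mono IH) simp
      also have "\<dots> \<le> c ^ card (prime_factors n \<inter> S) * real (p ^ k) powr \<eta> * real m powr \<eta>"
        using mult_right_mono[OF step, of "real m powr \<eta>"] by (simp only: mult.assoc) simp
      also have "\<dots> = c ^ card (prime_factors n \<inter> S) * real n powr \<eta>"
        unfolding nk by (simp add: powr_mult)
      finally show ?thesis .
    qed
  qed
  have "real (divisor_tau n) \<le> c ^ card S * real n powr \<eta>" if "n \<ge> 1" for n
  proof -
    have "c ^ card (prime_factors n \<inter> S) \<le> c ^ card S"
      using c1 finS by (intro power_increasing card_mono) auto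
    then show ?thesis
      using main[of n] that by (smt (verit) One_nat_def Suc_le_lessD mult_right_mono powr_ge_zero)
  qed
  moreover have "c ^ card S \<ge> 1" using c1 by simp
  ultimately show ?thesis by blast
qed

section \<open>Bounding Delta away from the diagonal\<close>

text \<open>Each of the \<open>divisor_tau n\<close> summands in \<open>n = (\<Sum>d | d dvd n. totient d)\<close> is at most
  \<open>totient n\<close>.\<close>
lemma le_divisor_tau_mult_totient:
  assumes "n > 0"
  shows "n \<le> divisor_tau n * totient n"
proof -
  have "n = (\<Sum>d | d dvd n. totient d)" by (simp add: totient_divisor_sum)
  also have "\<dots> \<le> (\<Sum>d | d dvd n. totient n)"
    using assms by (intro sum_mono totient_dvd_mono) auto
  finally show ?thesis by (simp add: divisor_tau_def)
qed

lemma sum_multiples_le_harm: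
  fixes d L :: nat
  assumes "d > 0"
  shows "(\<Sum>q | q \<in> {1..L} \<and> d dvd q. real d / real q) \<le> harm L"
proof -
  have "(\<Sum>q | q \<in> {1..L} \<and> d dvd q. real d / real q) = (\<Sum>j\<in>{j. 1 \<le> j \<and> d * j \<le> L}. inverse (real j))"
  proof (rule sum.reindex_bij_witness[of _ "\<lambda>j. d * j" "\<lambda>q. q div d"])
    fix q assume q: "q \<in> {q. q \<in> {1..L} \<and> d dvd q}"
    then obtain j where j: "q = d * j" by blast
    then have "j \<noteq> 0" using q by (intro notI) simp
    then show "d * (q div d) = q" "q div d \<in> {j. 1 \<le> j \<and> d * j \<le> L}"
      "inverse (real (q div d)) = real d / real q"
      using j q assms by (simp_all add: inverse_eq_divide)
  next
    fix j assume "j \<in> {j. 1 \<le> j \<and> d * j \<le> L}"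
    then show "d * j div d = j" "d * j \<in> {q. q \<in> {1..L} \<and> d dvd q}"
      using assms by (simp_all add: Suc_le_eq)
  qed
  also have "\<dots> \<le> (\<Sum>j\<in>{1..L}. inverse (real j))"
  proof (rule sum_mono2)
    have "j \<le> d * j" for j using assms by simp
    then have "d * j \<le> L \<Longrightarrow> j \<le> L" for j using le_trans by blast
    then show "{j. 1 \<le> j \<and> d * j \<le> L} \<subseteq> {1..L}" by (intro subsetI) simp
  qed auto
  finally show ?thesis by (simp add: harm_def)
qed

text \<open>Insert the bound for primitive character sums and interchange summation: only the
  divisors \<open>d\<close> of \<open>m - n\<close> occur, and the moduli \<open>q\<close> divisible by a given \<open>d\<close> contribute a
  harmonic sum. The number \<open>T\<close> bounds \<open>q / totient q\<close>.\<close>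
lemma norm_Delta_le:
  assumes bound: "\<And>x. norm (\<Psi> x) \<le> M" and supp: "\<And>x. \<Psi> x \<noteq> 0 \<Longrightarrow> x \<le> c"
    and Q: "Q > 0" and L: "real L \<ge> c * Q"
    and T: "\<And>q. q \<in> {1..L} \<Longrightarrow> real (divisor_tau q) \<le> T" and mn: "m \<noteq> n" and T0: "T \<ge> 0"
  shows "norm (Delta \<Psi> Q m n) \<le> M * T * real (divisor_tau (nat \<bar>int m - int n\<bar>)) * harm L"
proof -
  have M: "M \<ge> 0" using bound[of 0] norm_ge_zero order_trans by blast
  let ?k = "nat \<bar>int m - int n\<bar>"
  let ?P = "\<lambda>q. \<Sum>ch | primitive_character q ch. ch m * cnj (ch n)"
  have k: "?k > 0" using mn by simp
  have fin: "finite {d. d dvd ?k}" by (rule finite_divisors_nat[OF k])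
  have zero: "\<Psi> (real q / Q) = 0" if "q > L" for q
  proof (rule ccontr)
    assume "\<Psi> (real q / Q) \<noteq> 0"
    then have "real q / Q \<le> c" by (rule supp)
    then have "real q \<le> c * Q" using Q by (simp add: pos_divide_le_eq)
    with L have "real q \<le> real L" by linarith
    with that show False by simp
  qed
  have "Delta \<Psi> Q m n = (\<Sum>\<^sub>\<infinity>q\<in>{1..L}. \<Psi> (real q / Q) / of_nat (totient q) * ?P q)"
    unfolding Delta_def by (rule infsum_cong_neutral) (auto simp: zero)
  also have "\<dots> = (\<Sum>q\<in>{1..L}. \<Psi> (real q / Q) / of_nat (totient q) * ?P q)" by simp
  also have "norm \<dots> \<le> (\<Sum>q\<in>{1..L}. norm (\<Psi> (real q / Q) / of_nat (totient q) * ?P q))"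
    by (rule norm_sum)
  also have "\<dots> \<le> (\<Sum>q\<in>{1..L}. M * T * (\<Sum>d | d \<in> {d. d dvd ?k} \<and> d dvd q. real d / real q))"
  proof (rule sum_mono)
    fix q assume q: "q \<in> {1..L}"
    have q0: "q > 0" "totient q > 0" using q by auto
    have "real q \<le> real (divisor_tau q) * real (totient q)"
      using le_divisor_tau_mult_totient[OF q0(1)] by (metis of_nat_le_iff of_nat_mult)
    also have "\<dots> \<le> T * real (totient q)" using T[OF q] by (intro mult_right_mono) auto
    finally have tot: "1 / real (totient q) \<le> T / real q" using q0 by (simp add: field_simps)
    have "{d. d dvd q \<and> [m = n] (mod d)} = {d. d \<in> {d. d dvd ?k} \<and> d dvd q}"
      by (auto simp: cong_altdef_nat')
    then have P: "norm (?P q) \<le> (\<Sum>d | d \<in> {d. d dvd ?k} \<and> d dvd q. real d)"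
      using norm_sum_primitive_characters_le[OF q0(1), of m n] by simp
    have "norm (\<Psi> (real q / Q) / of_nat (totient q) * ?P q)
      = norm (\<Psi> (real q / Q)) * (1 / real (totient q)) * norm (?P q)"
      by (simp add: norm_mult norm_divide)
    also have "\<dots> \<le> M * (T / real q) * (\<Sum>d | d \<in> {d. d dvd ?k} \<and> d dvd q. real d)"
      using bound M T0 by (intro mult_mono tot P mult_nonneg_nonneg) auto
    also have "\<dots> = M * T * (\<Sum>d | d \<in> {d. d dvd ?k} \<and> d dvd q. real d / real q)"
      by (simp add: sum_divide_distrib[symmetric])
    finally show "norm (\<Psi> (real q / Q) / of_nat (totient q) * ?P q)
      \<le> M * T * (\<Sum>d | d \<in> {d. d dvd ?k} \<and> d dvd q. real d / real q)" .
  qed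
  also have "\<dots> = M * T * (\<Sum>q\<in>{1..L}. \<Sum>d | d \<in> {d. d dvd ?k} \<and> d dvd q. real d / real q)"
    by (simp only: sum_distrib_left)
  also have "\<dots> = M * T * (\<Sum>d\<in>{d. d dvd ?k}. \<Sum>q | q \<in> {1..L} \<and> d dvd q. real d / real q)"
    by (subst sum.swap_restrict) (use fin in auto)
  also have "\<dots> \<le> M * T * (\<Sum>d\<in>{d. d dvd ?k}. harm L)"
    using M T0 dvd_pos_nat[OF k] by (intro mult_left_mono sum_mono sum_multiples_le_harm) (simp_all only: mem_Collect_eq mult_nonneg_nonneg)
  also have "\<dots> = M * T * real (divisor_tau ?k) * harm L" by (simp add: divisor_tau_def)
  finally show ?thesis .
qed

lemma harm_le_1_plus_ln:
  assumes "n > 0"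
  shows "harm n \<le> (1 + ln (real n) :: real)"
proof -
  have "harm (Suc (n - 1)) - ln (real (Suc (n - 1))) \<le> harm (Suc 0) - ln (real (Suc 0))"
    by (rule decseqD[OF decseq_harm_diff_ln]) simp
  then show ?thesis using assms by (simp add: harm_def)
qed

text \<open>By induction, as \<open>1 / b \<le> 2 * (b - a)\<close> for \<open>a = sqrt n\<close> and \<open>b = sqrt (n + 1)\<close>.\<close>
lemma sum_powr_minus_half_le:
  "(\<Sum>m=1..n. real m powr (-1/2)) \<le> 2 * sqrt (real n)"
proof (induction n)
  case (Suc n)
  define a b where "a = sqrt (real n)" and "b = sqrt (real (Suc n))"
  have ab: "a \<ge> 0" "b > 0" "b ^ 2 = a ^ 2 + 1" by (auto simp: a_def b_def)
  have "real (Suc n) powr (-1/2) = 1 / b"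
    by (simp add: b_def powr_minus_divide powr_half_sqrt[symmetric])
  moreover have "1 / b \<le> 2 * b - 2 * a"
  proof -
    have "0 \<le> (b - a) ^ 2" by simp
    then have "1 \<le> (2 * b - 2 * a) * b"
      using ab(3) by (simp add: power2_eq_square algebra_simps)
    then show ?thesis using ab(2) by (simp add: field_simps)
  qed
  ultimately show ?case using Suc by (simp add: a_def b_def)
qed simp

section \<open>The off-diagonal sum\<close>

lemma S_full_minus_S_diag:
  assumes "\<And>m n :: nat. F (real m) (real n) \<noteq> 0 \<Longrightarrow> m \<le> k \<and> n \<le> k"
  shows "S_full \<Psi> Q F a b - S_diag \<Psi> Q F a b =
    (\<Sum>m=1..k. \<Sum>n=1..k. if m = n then 0 else a m * b n * F (real m) (real n) * Delta \<Psi> Q m n)"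
proof -
  let ?t = "\<lambda>m n. a m * b n * F (real m) (real n) * Delta \<Psi> Q m n"
  have zero: "F (real m) (real n) = 0" if "m > k \<or> n > k" for m n :: nat
    using assms[of m n] that by linarith
  have inner: "(\<Sum>\<^sub>\<infinity>n\<in>{1..}. ?t m n) = (\<Sum>n=1..k. ?t m n)" for m
  proof -
    have "(\<Sum>\<^sub>\<infinity>n\<in>{1..}. ?t m n) = (\<Sum>\<^sub>\<infinity>n\<in>{1..k}. ?t m n)"
      by (rule infsum_cong_neutral) (auto simp: zero)
    then show ?thesis by simp
  qed
  have "S_full \<Psi> Q F a b = (\<Sum>\<^sub>\<infinity>m\<in>{1..k}. \<Sum>n=1..k. ?t m n)"
    unfolding S_full_def inner by (rule infsum_cong_neutral) (auto simp: zero)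
  moreover have "S_diag \<Psi> Q F a b = (\<Sum>\<^sub>\<infinity>m\<in>{1..k}. ?t m m)"
    unfolding S_diag_def by (rule infsum_cong_neutral) (auto simp: zero)
  ultimately have "S_full \<Psi> Q F a b - S_diag \<Psi> Q F a b =
      (\<Sum>m=1..k. (\<Sum>n=1..k. ?t m n) - ?t m m)"
    by (simp add: sum_subtractf)
  also have "\<dots> = (\<Sum>m=1..k. \<Sum>n=1..k. if m = n then 0 else ?t m n)"
  proof (rule sum.cong[OF refl])
    fix m assume m: "m \<in> {1..k}"
    have "(\<Sum>n=1..k. if m = n then 0 else ?t m n) = (\<Sum>n=1..k. ?t m n - (if m = n then ?t m n else 0))"
      by (intro sum.cong) auto
    also have "\<dots> = (\<Sum>n=1..k. ?t m n) - ?t m m"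
      using m by (simp add: sum_subtractf)
    finally show "(\<Sum>n=1..k. ?t m n) - ?t m m = (\<Sum>n=1..k. if m = n then 0 else ?t m n)" by simp
  qed
  finally show ?thesis .
qed

lemma smooth_compact_support_bounded:
  assumes "smooth \<Psi>" and "compact (closure {x. \<Psi> x \<noteq> 0})"
  obtains M c where "M \<ge> 0" "c \<ge> 1" "\<And>x. norm (\<Psi> x) \<le> M" "\<And>x. \<Psi> x \<noteq> 0 \<Longrightarrow> x \<le> c"
proof -
  let ?S = "closure {x. \<Psi> x \<noteq> 0}"
  have "\<Psi> differentiable (at x)" for x
    using assms(1) unfolding smooth_def by (metis funpow_0)
  then have "continuous_on ?S \<Psi>"
    by (intro differentiable_imp_continuous_on differentiable_at_imp_differentiable_on) auto
  then have "bounded (\<Psi> ` ?S)"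
    using assms(2) compact_continuous_image compact_imp_bounded by blast
  then obtain M where M: "\<And>x. x \<in> ?S \<Longrightarrow> norm (\<Psi> x) \<le> M" unfolding bounded_iff by blast
  obtain c where c: "\<And>x. x \<in> ?S \<Longrightarrow> norm x \<le> c"
    using compact_imp_bounded[OF assms(2)] unfolding bounded_iff by blast
  have in_S: "x \<in> ?S" if "\<Psi> x \<noteq> 0" for x
    by (rule subsetD[OF closure_subset]) (simp add: that)
  have "norm (\<Psi> x) \<le> max M 0" for x
    using M[OF in_S, of x] by (cases "\<Psi> x = 0") auto
  moreover have "x \<le> max c 1" if "\<Psi> x \<noteq> 0" for x
    using c[OF in_S[OF that]] by auto
  ultimately show ?thesis using that[of "max M 0" "max c 1"] by auto
qed

lemma power_saving_beats_log:
  fixes \<delta> C c :: real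
  assumes "\<delta> > 0" "c > 0"
  shows "\<forall>\<^sub>F Q in at_top. Q powr (1 - \<delta>) * (2 + ln (c * Q)) \<le> Q * ln Q powr (- C)"
  using assms by real_asymp

text \<open>All divisor functions in sight are at most \<open>T\<close>: each coefficient costs \<open>T powr A\<close>,
  and \<open>Delta\<close> costs one \<open>T\<close> for the loss in \<open>q / totient q\<close> and one for the divisors of
  \<open>m - n\<close>.\<close>
lemma norm_S_full_minus_S_diag_le:
  fixes T A :: real
  assumes bound: "\<And>x. norm (\<Psi> x) \<le> M" and supp: "\<And>x. \<Psi> x \<noteq> 0 \<Longrightarrow> x \<le> c"
    and c: "c \<ge> 1" and Q: "Q \<ge> 1" and N: "0 \<le> N" "N \<le> Q" and A: "A \<ge> 0"
    and T: "\<And>n. n \<ge> 1 \<Longrightarrow> real n \<le> c * Q + 1 \<Longrightarrow> real (divisor_tau n) \<le> T"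
    and a: "\<And>m. m \<ge> 1 \<Longrightarrow> norm (a m) \<le> real m powr (-1/2) * real (divisor_tau m) powr A"
    and b: "\<And>n. n \<ge> 1 \<Longrightarrow> norm (b n) \<le> real n powr (-1/2) * real (divisor_tau n) powr A"
    and F: "\<And>x y. norm (F x y) \<le> 1"
    and F_supp: "\<And>x y. F x y \<noteq> 0 \<Longrightarrow> x \<le> N \<and> y \<le> N"
  shows "norm (S_full \<Psi> Q F a b - S_diag \<Psi> Q F a b)
    \<le> 4 * N * M * T powr (2 * A + 2) * (2 + ln (c * Q))"
proof -
  define k where "k = nat \<lfloor>N\<rfloor>"
  define L where "L = nat \<lceil>c * Q\<rceil>"
  define R where "R = M * T * T * (2 + ln (c * Q))"
  have M: "M \<ge> 0" using bound[of 0] norm_ge_zero order_trans by blast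
  have cQ: "c * Q \<ge> Q" using c Q by simp
  then have cQ1: "c * Q \<ge> 1" using Q by linarith
  have L: "real L \<ge> c * Q" "real L \<le> c * Q + 1" "L > 0"
    using cQ1 unfolding L_def by linarith+
  have k: "real k \<le> N" "\<And>n. real n \<le> N \<Longrightarrow> n \<le> k"
    using N unfolding k_def by (auto simp: le_nat_iff le_floor_iff)
  have T1: "T \<ge> 1" using T[of 1] cQ1 by (simp add: divisor_tau_def)
  have tau: "real (divisor_tau n) \<le> T" if "n \<ge> 1" "n \<le> k" for n
  proof (rule T[OF that(1)])
    have "real n \<le> real k" using that by simp
    then show "real n \<le> c * Q + 1" using k(1) N cQ by linarith
  qed
  have harm: "harm L \<le> 2 + ln (c * Q)"
  proof -
    have "ln (real L) \<le> ln (2 * (c * Q))" using L cQ1 by (intro ln_mono) auto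
    also have "\<dots> \<le> 1 + ln (c * Q)" using cQ1 ln_2_less_1 by (simp add: ln_mult)
    finally show ?thesis using harm_le_1_plus_ln[OF L(3)] by linarith
  qed
  have Delta: "norm (Delta \<Psi> Q m n) \<le> R" if "m \<in> {1..k}" "n \<in> {1..k}" "m \<noteq> n" for m n
  proof -
    have diff: "1 \<le> nat \<bar>int m - int n\<bar>" "nat \<bar>int m - int n\<bar> \<le> k" using that by auto
    have "norm (Delta \<Psi> Q m n) \<le> M * T * real (divisor_tau (nat \<bar>int m - int n\<bar>)) * harm L"
    proof (rule norm_Delta_le[OF bound supp _ L(1) _ that(3)])
      fix q assume q: "q \<in> {1..L}"
      then have "real q \<le> real L" by simp
      then have "real q \<le> c * Q + 1" using L(2) by linarith
      then show "real (divisor_tau q) \<le> T" using q by (intro T) auto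
    qed (use Q T1 in auto)
    also have "\<dots> \<le> M * T * T * (2 + ln (c * Q))"
      using M T1 harm tau[OF diff] harm_nonneg[of L, where 'a = real]
      by (intro mult_mono mult_nonneg_nonneg) auto
    finally show ?thesis by (simp add: R_def)
  qed
  have R0: "R \<ge> 0"
    using M T1 cQ1 unfolding R_def by (intro mult_nonneg_nonneg add_nonneg_nonneg ln_ge_zero) auto
  have coeff: "norm (g m) \<le> real m powr (-1/2) * T powr A"
    if "norm (g m) \<le> real m powr (-1/2) * real (divisor_tau m) powr A" "m \<in> {1..k}"
    for g :: "nat \<Rightarrow> complex" and m
  proof -
    have "real m powr (-1/2) * real (divisor_tau m) powr A \<le> real m powr (-1/2) * T powr A"
      using tau that A by (intro mult_left_mono powr_mono2) auto
    then show ?thesis using that(1) by linarith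
  qed
  have "norm (S_full \<Psi> Q F a b - S_diag \<Psi> Q F a b) =
     norm (\<Sum>m=1..k. \<Sum>n=1..k. if m = n then 0 else a m * b n * F (real m) (real n) * Delta \<Psi> Q m n)"
    using F_supp k(2) by (subst S_full_minus_S_diag[where k = k]) auto
  also have "\<dots> \<le> (\<Sum>m=1..k. \<Sum>n=1..k. real m powr (-1/2) * real n powr (-1/2) * (T powr A * T powr A * R))"
  proof (intro sum_norm_le)
    fix m n assume m: "m \<in> {1..k}" and n: "n \<in> {1..k}"
    show "norm (if m = n then 0 else a m * b n * F (real m) (real n) * Delta \<Psi> Q m n)
      \<le> real m powr (-1/2) * real n powr (-1/2) * (T powr A * T powr A * R)"
    proof (cases "m = n")
      case True
      then show ?thesis using R0 by simp
    next
      case False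
      have "norm (a m * b n * F (real m) (real n) * Delta \<Psi> Q m n) =
         norm (a m) * norm (b n) * norm (F (real m) (real n)) * norm (Delta \<Psi> Q m n)"
        by (simp add: norm_mult)
      also have "\<dots> \<le> (real m powr (-1/2) * T powr A) * (real n powr (-1/2) * T powr A) * 1 * R"
        using m n by (intro mult_mono coeff a b F Delta False mult_nonneg_nonneg) auto
      finally show ?thesis using False by (simp add: mult_ac)
    qed
  qed
  also have "\<dots> = (\<Sum>m=1..k. real m powr (-1/2)) * (\<Sum>n=1..k. real n powr (-1/2)) * (T powr A * T powr A * R)"
    by (subst sum_product) (simp only: sum_distrib_right)
  also have "\<dots> \<le> (2 * sqrt (real k)) * (2 * sqrt (real k)) * (T powr A * T powr A * R)"
    using R0 by (intro mult_right_mono mult_mono sum_powr_minus_half_le) (auto intro: sum_nonneg)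
  also have "\<dots> = 4 * real k * (T powr A * T powr A * R)" by simp
  also have "\<dots> \<le> 4 * N * (T powr A * T powr A * R)"
    using k R0 by (intro mult_right_mono) auto
  also have "\<dots> = 4 * N * M * T powr (2 * A + 2) * (2 + ln (c * Q))"
  proof -
    have "T powr (2 * A + 2) = T powr A * T powr A * T * T"
      using T1 by (simp only: mult_2 powr_add powr_numeral power2_eq_square mult.assoc)
    then show ?thesis by (simp add: R_def mult_ac)
  qed
  finally show ?thesis .
qed

theorem theorem2p2:
  fixes \<Psi> :: "real \<Rightarrow> complex" and \<epsilon> A C :: real
  assumes "smooth \<Psi>"
    and "compact (closure {x. \<Psi> x \<noteq> 0})"
    and "closure {x. \<Psi> x \<noteq> 0} \<subseteq> {0<..}"
    and "\<epsilon> > 0" and "A \<ge> 0" and "C > 0"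
  shows "\<exists>K::real. \<forall>\<^sub>F Q::real in at_top.
     \<forall>(N::real) (a :: nat \<Rightarrow> complex) (b :: nat \<Rightarrow> complex) (F :: real \<Rightarrow> real \<Rightarrow> complex).
       2 \<le> N \<and> N \<le> Q powr (1 - \<epsilon>) \<and>
       (\<forall>m\<ge>1. norm (a m) \<le> real m powr (-1/2) * real (divisor_tau m) powr A) \<and>
       (\<forall>n\<ge>1. norm (b n) \<le> real n powr (-1/2) * real (divisor_tau n) powr A) \<and>
       smooth2 F \<and>
       (\<forall>x y. F x y \<noteq> 0 \<longrightarrow> x \<in> {1..N} \<and> y \<in> {1..N}) \<and>
       (\<forall>i\<le>2. \<forall>j\<le>2. \<forall>x y. x ^ i * y ^ j * norm (mixed_partial i j F x y) \<le> 1)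
       \<longrightarrow> norm (S_full \<Psi> Q F a b - S_diag \<Psi> Q F a b) \<le> K * (Q * ln Q powr (- C))"
proof -
  obtain M c where Mc: "M \<ge> 0" "c \<ge> 1" and bound: "\<And>x. norm (\<Psi> x) \<le> M"
    and supp: "\<And>x. \<Psi> x \<noteq> 0 \<Longrightarrow> x \<le> c"
    using smooth_compact_support_bounded[OF assms(1,2)] by blast
  \<comment> \<open>The factor \<open>T powr (2 * A + 2)\<close> is to cost \<open>Q powr (\<epsilon> / 2)\<close>, half of what \<open>N \<le> Q powr (1 - \<epsilon>)\<close> saves.\<close>
  define \<eta> where "\<eta> = \<epsilon> / (2 * (2 * A + 2))"
  have \<eta>: "\<eta> > 0" "\<eta> * (2 * A + 2) = \<epsilon> / 2"
    using assms by (auto simp: \<eta>_def field_simps)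
  obtain B where B: "B \<ge> 1" "\<And>n. n \<ge> 1 \<Longrightarrow> real (divisor_tau n) \<le> B * real n powr \<eta>"
    using divisor_bound[OF \<eta>(1)] by blast
  define K where "K = 4 * M * B powr (2 * A + 2) * (2 * c) powr (\<epsilon> / 2)"
  have K: "K \<ge> 0" using Mc B by (simp add: K_def)
  show ?thesis
  proof (intro exI[of _ K])
    have "\<forall>\<^sub>F Q in at_top. Q powr (1 - \<epsilon> / 2) * (2 + ln (c * Q)) \<le> Q * ln Q powr (- C)"
      using assms Mc by (intro power_saving_beats_log) auto
    moreover have "\<forall>\<^sub>F Q::real in at_top. Q \<ge> 1" by (rule eventually_ge_at_top)
    ultimately show "\<forall>\<^sub>F Q::real in at_top.
     \<forall>(N::real) (a :: nat \<Rightarrow> complex) (b :: nat \<Rightarrow> complex) (F :: real \<Rightarrow> real \<Rightarrow> complex).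
       2 \<le> N \<and> N \<le> Q powr (1 - \<epsilon>) \<and>
       (\<forall>m\<ge>1. norm (a m) \<le> real m powr (-1/2) * real (divisor_tau m) powr A) \<and>
       (\<forall>n\<ge>1. norm (b n) \<le> real n powr (-1/2) * real (divisor_tau n) powr A) \<and>
       smooth2 F \<and>
       (\<forall>x y. F x y \<noteq> 0 \<longrightarrow> x \<in> {1..N} \<and> y \<in> {1..N}) \<and>
       (\<forall>i\<le>2. \<forall>j\<le>2. \<forall>x y. x ^ i * y ^ j * norm (mixed_partial i j F x y) \<le> 1)
       \<longrightarrow> norm (S_full \<Psi> Q F a b - S_diag \<Psi> Q F a b) \<le> K * (Q * ln Q powr (- C))"
    proof (eventually_elim, intro allI impI, elim conjE)
      fix Q N :: real and a b :: "nat \<Rightarrow> complex" and F :: "real \<Rightarrow> real \<Rightarrow> complex"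
      assume saving: "Q powr (1 - \<epsilon> / 2) * (2 + ln (c * Q)) \<le> Q * ln Q powr (- C)" and Q: "1 \<le> Q"
        and N: "2 \<le> N" "N \<le> Q powr (1 - \<epsilon>)"
        and a: "\<forall>m\<ge>1. norm (a m) \<le> real m powr (-1/2) * real (divisor_tau m) powr A"
        and b: "\<forall>n\<ge>1. norm (b n) \<le> real n powr (-1/2) * real (divisor_tau n) powr A"
        and F_supp: "\<forall>x y. F x y \<noteq> 0 \<longrightarrow> x \<in> {1..N} \<and> y \<in> {1..N}"
        and F: "\<forall>i\<le>2. \<forall>j\<le>2. \<forall>x y. x ^ i * y ^ j * norm (mixed_partial i j F x y) \<le> 1"
      have F1: "norm (F x y) \<le> 1" for x y
        using F[rule_format, of 0 0 x y] by (simp add: mixed_partial_def)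
      have "Q powr (1 - \<epsilon>) \<le> Q powr 1" using Q assms by (intro powr_mono) auto
      then have NQ: "N \<le> Q" using N Q by simp
      \<comment> \<open>The moduli are at most \<open>c * Q + 1 \<le> 2 * c * Q\<close>.\<close>
      define T where "T = B * (2 * c * Q) powr \<eta>"
      have cQ: "c * Q \<ge> 1" using Mc Q mult_mono[of 1 c 1 Q] by simp
      have T: "real (divisor_tau n) \<le> T" if "n \<ge> 1" "real n \<le> c * Q + 1" for n
      proof -
        have "B * real n powr \<eta> \<le> T"
          unfolding T_def using that B cQ \<eta> by (intro mult_left_mono powr_mono2) auto
        then show ?thesis using B(2)[OF that(1)] by linarith
      qed
      have "norm (S_full \<Psi> Q F a b - S_diag \<Psi> Q F a b)
          \<le> 4 * N * M * T powr (2 * A + 2) * (2 + ln (c * Q))"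
        using N F_supp a b
        by (intro norm_S_full_minus_S_diag_le[OF bound supp Mc(2) Q _ NQ assms(5) T]) (auto intro: F1)
      also have "T powr (2 * A + 2) = B powr (2 * A + 2) * (2 * c * Q) powr (\<eta> * (2 * A + 2))"
        using B by (simp only: T_def powr_mult powr_powr)
      also have "\<dots> = B powr (2 * A + 2) * (2 * c) powr (\<epsilon> / 2) * Q powr (\<epsilon> / 2)"
        by (simp only: \<eta>(2) powr_mult mult.assoc)
      also have "4 * N * M * \<dots> * (2 + ln (c * Q)) = K * (N * Q powr (\<epsilon> / 2) * (2 + ln (c * Q)))"
        by (simp add: K_def mult_ac)
      also have "\<dots> \<le> K * (Q powr (1 - \<epsilon>) * Q powr (\<epsilon> / 2) * (2 + ln (c * Q)))"
        using K N cQ by (intro mult_left_mono mult_right_mono) auto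
      also have "Q powr (1 - \<epsilon>) * Q powr (\<epsilon> / 2) = Q powr (1 - \<epsilon> / 2)"
        by (simp flip: powr_add)
      also have "K * (\<dots> * (2 + ln (c * Q))) \<le> K * (Q * ln Q powr (- C))"
        using saving K by (intro mult_left_mono) auto
      finally show "norm (S_full \<Psi> Q F a b - S_diag \<Psi> Q F a b) \<le> K * (Q * ln Q powr (- C))" .
    qed
  qed
qed

end
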